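(* For every $\alpha\in(0,1)\setminus\mathbb{Q}$, the dynamic asymptotic dimension of the groupoid $\mathcal{G}_\alpha$ associated to the one-sided Sturmian subshift $(\mathsf{X}_\alpha,\sigma_\alpha)$ is one.
   Context: Here $\mathbb{N}=\{0,1,2,\dots\}$ and $\mathbb{T}=\mathbb{R}/\mathbb{Z}$. Dynamic asymptotic dimension. An étale groupoid $\mathcal{G}$ with unit space $\mathcal{G}^{(0)}$ and source and range maps $s,r$ has dynamic asymptotic dimension at most $d\in\mathbb{N}$ if for any open and relatively compact subset $K\subseteq\mathcal{G}$ there exist open subsets $U_0,\dots,U_d\subseteq\mathcal{G}^{(0)}$ with $s(K)\cup r(K)\subseteq\bigcup_iU_i$ such that, for each $i=0,\dots,d$, the subgroupoid generated by $K_{U_i}:=\{g\in K:s(g),r(g)\in U_i\}$ is relatively compact in $\mathcal{G}$. The dynamic asymptotic dimension is the least such $d$. Sturmian subshift. For irrational $\alpha\in(0,1)$ let $R_\alpha(t)=t+\alpha\pmod 1$ on $\mathbb{T}$, and let $I_\alpha(t)=0$ for $t\in[0,1-\alpha)$, $I_\alpha(t)=1$ for $t\in[1-\alpha,1)$. The one-sided Sturmian subshift is $\mathsf{X}_\alpha=\overline{\{(I_\alpha(R_\alpha^i(t)))_{i\in\mathbb{N}}:t\in\mathbb{T}\}}\subseteq\{0,1\}^{\mathbb{N}}$ with shift $\sigma_\alpha(x)_i=x_{i+1}$; it satisfies $\sigma_\alpha(\mathsf{X}_\alpha)=\mathsf{X}_\alpha$. Cover. For $l\in\mathbb{N}$ and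 $x\in\mathsf{X}_\alpha$, let $P_l(x)$ be the set of words $\mu$ of length $l$ with $\mu x\in\mathsf{X}_\alpha$. Let $\mathcal{I}=\{(k,l)\in\mathbb{N}\times\mathbb{N}:k\leq l\}$, partially ordered by $(k_1,l_1)\preceq(k_2,l_2)$ iff $k_1\leq k_2$ and $l_1-k_1\leq l_2-k_2$. For $(k,l)\in\mathcal{I}$ write $x\sim_{k,l}x'$ iff $x_{[0,k)}=x'_{[0,k)}$ and $P_l(\sigma_\alpha^k(x))=P_l(\sigma_\alpha^k(x'))$; let ${}_k[x]_l$ be the class of $x$ and ${}_k\mathsf{X}_l$ the finite (discrete) set of classes. If $(k_1,l_1)\preceq(k_2,l_2)$ there is a well-defined surjection ${}_{k_2}\mathsf{X}_{l_2}\to{}_{k_1}\mathsf{X}_{l_1}$, ${}_{k_2}[x]_{l_2}\mapsto{}_{k_1}[x]_{l_1}$. The cover $\tilde{\mathsf{X}}_\alpha$ is the projective limit of this system (a totally disconnected compact Hausdorff space). For $\tilde{x}\in\tilde{\mathsf{X}}_\alpha$, let ${}_k\tilde{x}_l\in\mathsf{X}_\alpha$ denote any representative of its $(k,l)$-coordinate. The shift $\tilde{\sigma}_\alpha$ on $\tilde{\mathsf{X}}_\alpha$ (a surjective local homeomorphism) sends $\tilde{x}$ to the element with $(k,l)$-coordinate ${}_k[\sigma_\alpha({}_{k+1}\tilde{x}_{l+1})]_l$. Groupoid. $\mathcal{G}_\alpha=\{(\tilde{x},p,\tilde{y})\in\tilde{\mathsf{X}}_\alpha\times\mathbb{Z}\times\tilde{\mathsf{X}}_\alpha:\exists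 k,l\in\mathbb{N},\ \tilde{\sigma}_\alpha^k(\tilde{x})=\tilde{\sigma}_\alpha^l(\tilde{y}),\ p=k-l\}$, with product $(\tilde{x},p,\tilde{y})(\tilde{y},q,\tilde{z})=(\tilde{x},p+q,\tilde{z})$, inverse $(\tilde{x},p,\tilde{y})^{-1}=(\tilde{y},-p,\tilde{x})$, source $s(\tilde{x},p,\tilde{y})=\tilde{y}$, range $r(\tilde{x},p,\tilde{y})=\tilde{x}$, unit space identified with $\tilde{\mathsf{X}}_\alpha$. A basis for its topology is given by the sets $Z(\tilde{U},m,n,\tilde{V})=\{(\tilde{x},m-n,\tilde{y}):\tilde{x}\in\tilde{U},\ \tilde{y}\in\tilde{V},\ \tilde{\sigma}_\alpha^m(\tilde{x})=\tilde{\sigma}_\alpha^n(\tilde{y})\}$ with $\tilde{U},\tilde{V}\subseteq\tilde{\mathsf{X}}_\alpha$ open and $m,n\in\mathbb{N}$. It is a second-countable, locally compact Hausdorff étale groupoid. *)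

theory Defs
  imports "HOL-Analysis.Analysis" "HOL-Library.Extended_Nat"
begin

section \<open>Dynamic asymptotic dimension\<close>

text \<open>
  A topological groupoid with arrows of type \<open>'g\<close> and units of type \<open>'u\<close>.
  The arrow set and the unit space are the underlying sets of the two topologies. Units are
  kept as a separate space instead of being identified with identity arrows.
  \<open>gmult G g h\<close> is meaningful only for composable arrows, \<open>src G g = rng G h\<close>.
\<close>

record ('u, 'g) top_groupoid =
  unit_space :: "'u topology"
  arrow_space :: "'g topology"
  src :: "'g \<Rightarrow> 'u"
  rng :: "'g \<Rightarrow> 'u"
  gmult :: "'g \<Rightarrow> 'g \<Rightarrow> 'g"
  ginv :: "'g \<Rightarrow> 'g"

definition subgroupoid :: "('u, 'g) top_groupoid \<Rightarrow> 'g set \<Rightarrow> bool" where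
  "subgroupoid G H \<longleftrightarrow>
     H \<subseteq> topspace (arrow_space G) \<and>
     (\<forall>g\<in>H. ginv G g \<in> H) \<and>
     (\<forall>g\<in>H. \<forall>h\<in>H. src G g = rng G h \<longrightarrow> gmult G g h \<in> H)"

definition relatively_compact_in :: "'a topology \<Rightarrow> 'a set \<Rightarrow> bool" where
  "relatively_compact_in T S \<longleftrightarrow> S \<subseteq> topspace T \<and> compactin T (T closure_of S)"

definition dad_at_most :: "('u, 'g) top_groupoid \<Rightarrow> nat \<Rightarrow> bool" where
  "dad_at_most G d \<longleftrightarrow>
     (\<forall>K. openin (arrow_space G) K \<and> relatively_compact_in (arrow_space G) K \<longrightarrow>
        (\<exists>U :: nat \<Rightarrow> 'u set.
           (\<forall>i\<le>d. openin (unit_space G) (U i)) \<and>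
           src G ` K \<union> rng G ` K \<subseteq> (\<Union>i\<le>d. U i) \<and>
           (\<forall>i\<le>d. relatively_compact_in (arrow_space G)
              (subgroupoid G hull {g \<in> K. src G g \<in> U i \<and> rng G g \<in> U i}))))"

text \<open>
  The notion is intended for etale groupoids, but only the data of the record enter the
  definition. The value is \<open>\<infinity>\<close> when no bound exists (the infimum of the empty set).
\<close>

definition dyn_asymp_dim :: "('u, 'g) top_groupoid \<Rightarrow> enat" where
  "dyn_asymp_dim G = Inf {enat d | d. dad_at_most G d}"


section \<open>The one-sided Sturmian subshift\<close>

text \<open>
  The circle is represented by \<open>{0..<1}\<close>. The alphabet \<open>{0, 1}\<close> is taken inside \<open>nat\<close> with its
  discrete topology, so that \<open>nat \<Rightarrow> nat\<close> carries the product topology and the closure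
  below is the closure in \<open>{0, 1}\<^sup>\<nat>\<close>.
\<close>

definition rotation :: "real \<Rightarrow> real \<Rightarrow> real" where
  "rotation \<alpha> t = frac (t + \<alpha>)"

definition coding :: "real \<Rightarrow> real \<Rightarrow> nat" where
  "coding \<alpha> t = (if t < 1 - \<alpha> then 0 else 1)"

definition sturmian :: "real \<Rightarrow> (nat \<Rightarrow> nat) set" where
  "sturmian \<alpha> = closure {(\<lambda>i. coding \<alpha> ((rotation \<alpha> ^^ i) t)) | t. t \<in> {0..<1}}"

definition shift :: "(nat \<Rightarrow> nat) \<Rightarrow> nat \<Rightarrow> nat" where
  "shift x = (\<lambda>i. x (Suc i))"

definition prepend :: "nat list \<Rightarrow> (nat \<Rightarrow> nat) \<Rightarrow> nat \<Rightarrow> nat" where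
  "prepend \<mu> x = (\<lambda>i. if i < length \<mu> then \<mu> ! i else x (i - length \<mu>))"


section \<open>The cover\<close>

definition pasts :: "real \<Rightarrow> nat \<Rightarrow> (nat \<Rightarrow> nat) \<Rightarrow> nat list set" where
  "pasts \<alpha> l x = {\<mu>. length \<mu> = l \<and> prepend \<mu> x \<in> sturmian \<alpha>}"

definition cover_index :: "(nat \<times> nat) set" where
  "cover_index = {(k, l). k \<le> l}"

definition index_le :: "nat \<times> nat \<Rightarrow> nat \<times> nat \<Rightarrow> bool" where
  "index_le = (\<lambda>(k1, l1) (k2, l2). k1 \<le> k2 \<and> l1 - k1 \<le> l2 - k2)"

definition past_equiv :: "real \<Rightarrow> nat \<times> nat \<Rightarrow> ((nat \<Rightarrow> nat) \<times> (nat \<Rightarrow> nat)) set" where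
  "past_equiv \<alpha> = (\<lambda>(k, l). {(x, x'). x \<in> sturmian \<alpha> \<and> x' \<in> sturmian \<alpha> \<and>
     (\<forall>i<k. x i = x' i) \<and>
     pasts \<alpha> l ((shift ^^ k) x) = pasts \<alpha> l ((shift ^^ k) x')})"

definition past_class :: "real \<Rightarrow> nat \<times> nat \<Rightarrow> (nat \<Rightarrow> nat) \<Rightarrow> (nat \<Rightarrow> nat) set" where
  "past_class \<alpha> p x = past_equiv \<alpha> p `` {x}"

definition past_quotient :: "real \<Rightarrow> nat \<times> nat \<Rightarrow> (nat \<Rightarrow> nat) set set" where
  "past_quotient \<alpha> p = sturmian \<alpha> // past_equiv \<alpha> p"

text \<open>
  A point of the cover is a function on \<open>cover_index\<close>, extended by \<open>undefined\<close>. Its value at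
  \<open>p\<close> is an equivalence class, and \<open>representative c p\<close> is a choice of element in that class.
\<close>

type_synonym cover_point = "nat \<times> nat \<Rightarrow> (nat \<Rightarrow> nat) set"

definition representative :: "cover_point \<Rightarrow> nat \<times> nat \<Rightarrow> nat \<Rightarrow> nat" where
  "representative c p = (SOME x. x \<in> c p)"

definition cover :: "real \<Rightarrow> cover_point set" where
  "cover \<alpha> = {c \<in> (\<Pi>\<^sub>E p\<in>cover_index. past_quotient \<alpha> p).
     \<forall>p\<in>cover_index. \<forall>q\<in>cover_index. index_le p q \<longrightarrow>
       c p = past_class \<alpha> p (representative c q)}"

definition cover_topology :: "real \<Rightarrow> cover_point topology" where
  "cover_topology \<alpha> = subtopology
     (product_topology (\<lambda>p. discrete_topology (past_quotient \<alpha> p)) cover_index) (cover \<alpha>)"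

definition cover_shift :: "real \<Rightarrow> cover_point \<Rightarrow> cover_point" where
  "cover_shift \<alpha> c = (\<lambda>(k, l)\<in>cover_index.
     past_class \<alpha> (k, l) (shift (representative c (k + 1, l + 1))))"

lemma topspace_cover_topology: "topspace (cover_topology \<alpha>) = cover \<alpha>"
  by (auto simp: cover_topology_def cover_def)


section \<open>The groupoid\<close>

type_synonym arrow = "cover_point \<times> int \<times> cover_point"

definition sturmian_arrows :: "real \<Rightarrow> arrow set" where
  "sturmian_arrows \<alpha> = {(x, p, y). x \<in> cover \<alpha> \<and> y \<in> cover \<alpha> \<and>
     (\<exists>k l. (cover_shift \<alpha> ^^ k) x = (cover_shift \<alpha> ^^ l) y \<and> p = int k - int l)}"

definition basic_arrows ::
  "real \<Rightarrow> cover_point set \<Rightarrow> nat \<Rightarrow> nat \<Rightarrow> cover_point set \<Rightarrow> arrow set" where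
  "basic_arrows \<alpha> U m n V = {(x, int m - int n, y) | x y.
     x \<in> U \<and> y \<in> V \<and> (cover_shift \<alpha> ^^ m) x = (cover_shift \<alpha> ^^ n) y}"

definition arrow_basis :: "real \<Rightarrow> arrow set set" where
  "arrow_basis \<alpha> = {basic_arrows \<alpha> U m n V | U m n V.
     openin (cover_topology \<alpha>) U \<and> openin (cover_topology \<alpha>) V}"

definition sturmian_groupoid :: "real \<Rightarrow> (cover_point, arrow) top_groupoid" where
  "sturmian_groupoid \<alpha> = \<lparr>
     unit_space = cover_topology \<alpha>,
     arrow_space = topology (arbitrary union_of (\<lambda>W. W \<in> arrow_basis \<alpha>)),
     src = (\<lambda>(x, p, y). y),
     rng = (\<lambda>(x, p, y). x),
     gmult = (\<lambda>(x, p, y) (y', q, z). (x, p + q, z)),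
     ginv = (\<lambda>(x, p, y). (y, - p, x))\<rparr>"

text \<open>
  The HOL function \<open>topology\<close> is unspecified outside topologies, so we check that the unions
  of basic sets do form a topology, with the arrows as underlying set.
\<close>

lemma basic_arrows_Int:
  assumes "int m - int n = int m' - int n'" "m \<le> m'"
  shows "basic_arrows \<alpha> U m n V \<inter> basic_arrows \<alpha> U' m' n' V' =
    basic_arrows \<alpha> (U \<inter> U') m n (V \<inter> V')"
proof -
  define j where "j = m' - m"
  have j: "m' = j + m" "n' = j + n" using assms by (auto simp: j_def)
  have "(cover_shift \<alpha> ^^ m') x = (cover_shift \<alpha> ^^ n') y"
    if "(cover_shift \<alpha> ^^ m) x = (cover_shift \<alpha> ^^ n) y" for x y
    using that by (simp add: j funpow_add)
  then show ?thesis using assms(1) unfolding basic_arrows_def by auto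
qed

lemma openin_sturmian_groupoid:
  "openin (arrow_space (sturmian_groupoid \<alpha>)) = arbitrary union_of (\<lambda>W. W \<in> arrow_basis \<alpha>)"
proof -
  have "S \<inter> T \<in> arrow_basis \<alpha>" if ST: "S \<in> arrow_basis \<alpha>" "T \<in> arrow_basis \<alpha>" for S T
  proof -
    from ST obtain U m n V U' m' n' V' where
      S: "S = basic_arrows \<alpha> U m n V" and T: "T = basic_arrows \<alpha> U' m' n' V'" and
      op: "openin (cover_topology \<alpha>) U" "openin (cover_topology \<alpha>) V"
        "openin (cover_topology \<alpha>) U'" "openin (cover_topology \<alpha>) V'"
      unfolding arrow_basis_def by blast
    have basic: "basic_arrows \<alpha> A a b B \<in> arrow_basis \<alpha>"
      if "openin (cover_topology \<alpha>) A" "openin (cover_topology \<alpha>) B" for A a b B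
      using that unfolding arrow_basis_def by blast
    consider "int m - int n \<noteq> int m' - int n'"
      | "int m - int n = int m' - int n'" "m \<le> m'"
      | "int m' - int n' = int m - int n" "m' \<le> m" by linarith
    then show ?thesis
    proof cases
      case 1
      then have "S \<inter> T = basic_arrows \<alpha> {} 0 0 {}"
        unfolding S T basic_arrows_def by auto
      then show ?thesis using basic[of "{}" "{}"] by simp
    next
      case 2
      then show ?thesis unfolding S T using op by (auto simp: basic_arrows_Int intro!: basic)
    next
      case 3
      then show ?thesis unfolding S T using op
        by (subst Int_commute) (auto simp: basic_arrows_Int intro!: basic)
    qed
  qed
  then show ?thesis
    by (simp add: sturmian_groupoid_def istopology_base topology_inverse')
qed

lemma topspace_sturmian_groupoid:
  "topspace (arrow_space (sturmian_groupoid \<alpha>)) = sturmian_arrows \<alpha>"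
proof -
  have "topspace (arrow_space (sturmian_groupoid \<alpha>)) = \<Union>(arrow_basis \<alpha>)"
    unfolding topspace_def openin_sturmian_groupoid union_of_def arbitrary_def by blast
  also have "\<dots> = sturmian_arrows \<alpha>"
  proof
    show "\<Union>(arrow_basis \<alpha>) \<subseteq> sturmian_arrows \<alpha>"
      using openin_subset[of "cover_topology \<alpha>"]
      by (fastforce simp: arrow_basis_def basic_arrows_def sturmian_arrows_def
          topspace_cover_topology)
    show "sturmian_arrows \<alpha> \<subseteq> \<Union>(arrow_basis \<alpha>)"
    proof
      fix g assume "g \<in> sturmian_arrows \<alpha>"
      then obtain k l where "g \<in> basic_arrows \<alpha> (cover \<alpha>) k l (cover \<alpha>)"
        by (auto simp: sturmian_arrows_def basic_arrows_def)
      moreover have "openin (cover_topology \<alpha>) (cover \<alpha>)"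
        using openin_topspace[of "cover_topology \<alpha>"] by (simp add: topspace_cover_topology)
      ultimately show "g \<in> \<Union>(arrow_basis \<alpha>)" unfolding arrow_basis_def by blast
    qed
  qed
  finally show ?thesis .
qed

end

theory Submission
  imports Defs
begin

text \<open>
  The arrows \<open>(x, p, y)\<close> with \<open>\<sigma>\<^sup>m x = \<sigma>\<^sup>n y\<close>, \<open>p = m - n\<close> and \<open>m, n \<le> N\<close> form a compact open set,
  and a set of arrows is relatively compact iff it lies in one of these sets. The dimension is
  not \<open>0\<close>, because the arrows \<open>(x, 1, \<sigma> x)\<close> generate arrows \<open>(x, n, \<sigma>\<^sup>n x)\<close> with \<open>n\<close> arbitrarily large.

  For the upper bound fix \<open>N\<close> and choose a marker: a word occurring with bounded gaps in all
  points, any two of its occurrences being more than \<open>2N + 1\<close> apart. Let \<open>U\<^sub>0\<close> consist of the points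
  with a marker among the times \<open>0, \<dots>, N\<close>, and \<open>U\<^sub>1\<close> of the others. If \<open>\<sigma>\<^sup>m x = \<sigma>\<^sup>n y\<close> with \<open>m, n \<le> N\<close> and
  both points lie in the same \<open>U\<^sub>i\<close>, then they agree on the first marker after time \<open>N\<close>: writing \<open>s\<close>
  for its time, \<open>m - n = s x - s y\<close> and \<open>\<sigma>\<^bsup>s x\<^esup> x = \<sigma>\<^bsup>s y\<^esup> y\<close>. The arrows with this last property form a
  subgroupoid, and \<open>s\<close> is bounded.
\<close>

section \<open>Sturmian words and their pasts\<close>

lemma funpow_shift: "(shift ^^ k) x i = x (i + k)"
  by (induction k arbitrary: i) (auto simp: shift_def)

lemma funpow_rotation:
  assumes "t \<in> {0..<1}"
  shows "(rotation \<alpha> ^^ i) t = frac (t + real i * \<alpha>)"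
proof (induction i)
  case 0
  show ?case using assms by (simp add: frac_eq)
next
  case (Suc i)
  have "rotation \<alpha> (frac (t + real i * \<alpha>)) = frac (t + real i * \<alpha> + \<alpha>)"
    unfolding rotation_def by simp
  then show ?case using Suc by (simp add: algebra_simps)
qed

text \<open>Basic neighbourhoods in the product of discrete spaces fix finitely many letters, so
  membership in the closure is tested on prefixes. The angle \<open>t\<close> may be any real
  because \<open>frac\<close> discards its integer part; angles can then be moved by
  \<open>\<alpha>\<close> without normalisation.\<close>

lemma mem_sturmian_iff:
  "x \<in> sturmian \<alpha> \<longleftrightarrow> (\<forall>n. \<exists>t. \<forall>i<n. x i = coding \<alpha> (frac (t + real i * \<alpha>)))"
  (is "_ \<longleftrightarrow> (\<forall>n. ?P n)")
proof -
  define S where "S = {(\<lambda>i. coding \<alpha> ((rotation \<alpha> ^^ i) t)) | t. t \<in> {0..<1}}"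
  have S: "S = range (\<lambda>t i. coding \<alpha> (frac (t + real i * \<alpha>)))"
  proof safe
    fix t
    have "(rotation \<alpha> ^^ i) (frac t) = frac (t + real i * \<alpha>)" for i
      by (subst funpow_rotation) (auto simp: frac_lt_1)
    then show "(\<lambda>i. coding \<alpha> (frac (t + real i * \<alpha>))) \<in> S"
      unfolding S_def using frac_lt_1[of t] by (auto intro!: exI[of _ "frac t"])
  qed (auto simp: S_def funpow_rotation)
  show ?thesis
  proof
    assume x: "x \<in> sturmian \<alpha>"
    show "\<forall>n. ?P n"
    proof
      fix n
      have "open (Pi\<^sub>E UNIV (\<lambda>i. if i < n then {x i} else UNIV))"
        by (rule open_PiE) (auto intro: finite_subset[of _ "{..<n}"] open_discrete)
      moreover have "x \<in> Pi\<^sub>E UNIV (\<lambda>i. if i < n then {x i} else UNIV)"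
        by auto
      ultimately have "S \<inter> Pi\<^sub>E UNIV (\<lambda>i. if i < n then {x i} else UNIV) \<noteq> {}"
        using x unfolding sturmian_def S_def[symmetric] closure_iff_nhds_not_empty
        by (meson order_refl)
      then obtain y where y: "y \<in> S" "y \<in> Pi\<^sub>E UNIV (\<lambda>i. if i < n then {x i} else UNIV)"
        by (meson disjoint_iff)
      have "y i = x i" if "i < n" for i
        using PiE_mem[OF y(2), of i] that by simp
      moreover obtain t where "y = (\<lambda>i. coding \<alpha> (frac (t + real i * \<alpha>)))"
        using y(1) unfolding S by blast
      ultimately show "?P n" by metis
    qed
  next
    assume P: "\<forall>n. ?P n"
    have "T \<inter> S \<noteq> {}" if T: "open T" "x \<in> T" for T
    proof -
      obtain X where X: "x \<in> Pi\<^sub>E UNIV X" "finite {i. X i \<noteq> UNIV}" "Pi\<^sub>E UNIV X \<subseteq> T"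
        using product_topology_open_contains_basis[of "\<lambda>_. euclidean" UNIV T x] T
        unfolding open_fun_def topspace_euclidean by blast
      obtain n where n: "\<And>i. X i \<noteq> UNIV \<Longrightarrow> i < n"
        using X(2) unfolding finite_nat_iff_bounded by blast
      obtain t where t: "\<And>i. i < n \<Longrightarrow> x i = coding \<alpha> (frac (t + real i * \<alpha>))"
        using P by blast
      have "(\<lambda>i. coding \<alpha> (frac (t + real i * \<alpha>))) \<in> Pi\<^sub>E UNIV X"
        using X(1) n t unfolding PiE_UNIV_domain Pi_iff by (metis UNIV_I)
      then show ?thesis using X(3) unfolding S by blast
    qed
    then show "x \<in> sturmian \<alpha>"
      unfolding sturmian_def S_def[symmetric] closure_iff_nhds_not_empty by blast
  qed
qed

lemma coding_le_1: "coding \<alpha> t \<le> 1"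
  by (simp add: coding_def)

lemma sturmian_le_1: "x \<in> sturmian \<alpha> \<Longrightarrow> x i \<le> 1"
proof -
  assume "x \<in> sturmian \<alpha>"
  then obtain t where "\<And>j. j < Suc i \<Longrightarrow> x j = coding \<alpha> (frac (t + real j * \<alpha>))"
    unfolding mem_sturmian_iff by blast
  then show ?thesis using coding_le_1 by simp
qed

lemma sturmian_nonempty: "sturmian \<alpha> \<noteq> {}"
proof -
  have "(\<lambda>i. coding \<alpha> (frac (0 + real i * \<alpha>))) \<in> sturmian \<alpha>"
    unfolding mem_sturmian_iff by blast
  then show ?thesis by blast
qed

lemma shift_in_sturmian:
  assumes "x \<in> sturmian \<alpha>"
  shows "shift x \<in> sturmian \<alpha>"
  unfolding mem_sturmian_iff
proof
  fix n
  obtain t where t: "\<And>i. i < Suc n \<Longrightarrow> x i = coding \<alpha> (frac (t + real i * \<alpha>))"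
    using assms unfolding mem_sturmian_iff by blast
  have "shift x i = coding \<alpha> (frac ((t + \<alpha>) + real i * \<alpha>))" if "i < n" for i
    using t[of "Suc i"] that by (simp add: shift_def algebra_simps)
  then show "\<exists>t. \<forall>i<n. shift x i = coding \<alpha> (frac (t + real i * \<alpha>))" by blast
qed

lemma funpow_shift_in_sturmian: "x \<in> sturmian \<alpha> \<Longrightarrow> (shift ^^ k) x \<in> sturmian \<alpha>"
  by (induction k) (auto intro: shift_in_sturmian)

section \<open>Left extensions, pasts and the equivalence relations of the cover\<close>

lemma prepend_Nil [simp]: "prepend [] x = x"
  by (simp add: prepend_def)

lemma prepend_append: "prepend (\<mu> @ \<nu>) x = prepend \<mu> (prepend \<nu> x)"
  by (auto simp: prepend_def nth_append fun_eq_iff)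

lemma funpow_shift_prepend: "(shift ^^ length \<mu>) (prepend \<mu> x) = x"
  by (auto simp: prepend_def funpow_shift fun_eq_iff)

lemma prepend_funpow_shift: "prepend (map x [k..<k + j]) ((shift ^^ (k + j)) x) = (shift ^^ k) x"
  by (auto simp: prepend_def funpow_shift fun_eq_iff add.commute)

text \<open>A compactness argument: the angle \<open>t - \<alpha>\<close> extends each prefix of
  \<open>x\<close> to the left by one letter. There are only two letters and \<open>Q n a\<close> is
  decreasing in \<open>n\<close>, so one letter serves all prefixes at once.\<close>

lemma ex_prepend_letter:
  assumes "x \<in> sturmian \<alpha>"
  shows "\<exists>a. prepend [a] x \<in> sturmian \<alpha>"
proof -
  define Q where "Q n a \<longleftrightarrow>
    (\<exists>t. \<forall>i<n. prepend [a] x i = coding \<alpha> (frac (t + real i * \<alpha>)))" for n a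
  have mono: "Q n a" if "Q m a" "n \<le> m" for n m a
    using that unfolding Q_def by (meson less_le_trans)
  have "Q n 0 \<or> Q n 1" for n
  proof -
    obtain t where t: "\<And>i. i < n \<Longrightarrow> x i = coding \<alpha> (frac (t + real i * \<alpha>))"
      using assms unfolding mem_sturmian_iff by blast
    define a where "a = coding \<alpha> (frac (t - \<alpha>))"
    have "prepend [a] x i = coding \<alpha> (frac ((t - \<alpha>) + real i * \<alpha>))" if "i < n" for i
      using t[of "i - 1"] that by (cases i) (auto simp: prepend_def a_def algebra_simps)
    then have "Q n a" unfolding Q_def by blast
    moreover have "a = 0 \<or> a = 1" unfolding a_def coding_def by simp
    ultimately show ?thesis by auto
  qed
  then have "(\<forall>n. Q n 0) \<or> (\<forall>n. Q n 1)"
    by (metis mono nat_le_linear)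
  then show ?thesis unfolding mem_sturmian_iff Q_def by blast
qed

lemma ex_prepend:
  assumes "x \<in> sturmian \<alpha>"
  shows "\<exists>\<mu>. length \<mu> = n \<and> prepend \<mu> x \<in> sturmian \<alpha>"
proof (induction n)
  case 0
  show ?case using assms by simp
next
  case (Suc n)
  then obtain \<mu> a where "length \<mu> = n" "prepend [a] (prepend \<mu> x) \<in> sturmian \<alpha>"
    using ex_prepend_letter by metis
  then show ?case by (intro exI[of _ "a # \<mu>"]) (simp flip: prepend_append)
qed

text \<open>Every past extends further to the left, and removing initial letters of a past amounts
  to shifting. Hence longer pasts determine shorter ones.\<close>

lemma pasts_restrict:
  assumes "l \<le> m"
  shows "pasts \<alpha> l x = {\<mu>. \<exists>\<nu>. length \<nu> = m - l \<and> length \<mu> = l \<and> \<nu> @ \<mu> \<in> pasts \<alpha> m x}"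
proof (intro set_eqI iffI)
  fix \<mu> assume "\<mu> \<in> pasts \<alpha> l x"
  then have "length \<mu> = l" "prepend \<mu> x \<in> sturmian \<alpha>" by (auto simp: pasts_def)
  then show "\<mu> \<in> {\<mu>. \<exists>\<nu>. length \<nu> = m - l \<and> length \<mu> = l \<and> \<nu> @ \<mu> \<in> pasts \<alpha> m x}"
    using assms ex_prepend[of "prepend \<mu> x" \<alpha> "m - l"] by (auto simp: pasts_def prepend_append)
next
  fix \<mu> assume "\<mu> \<in> {\<mu>. \<exists>\<nu>. length \<nu> = m - l \<and> length \<mu> = l \<and> \<nu> @ \<mu> \<in> pasts \<alpha> m x}"
  then obtain \<nu> where "length \<mu> = l" "prepend \<nu> (prepend \<mu> x) \<in> sturmian \<alpha>"
    by (auto simp: pasts_def prepend_append)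
  then show "\<mu> \<in> pasts \<alpha> l x"
    using funpow_shift_in_sturmian[of _ \<alpha> "length \<nu>"] funpow_shift_prepend[of \<nu>]
    by (fastforce simp: pasts_def)
qed

lemma pasts_mono_cong:
  assumes "pasts \<alpha> m x = pasts \<alpha> m y" "l \<le> m"
  shows "pasts \<alpha> l x = pasts \<alpha> l y"
  unfolding pasts_restrict[OF assms(2)] assms(1) ..

lemma pasts_funpow_shift:
  "pasts \<alpha> l ((shift ^^ k) x) =
    {\<mu>. length \<mu> = l \<and> \<mu> @ map x [k..<k + j] \<in> pasts \<alpha> (l + j) ((shift ^^ (k + j)) x)}"
  by (simp add: pasts_def prepend_append prepend_funpow_shift)

text \<open>This makes the bonding maps of the projective system well defined. Going back from
  \<open>k'\<close> to \<open>k = k' - j\<close> moves \<open>j\<close> letters of the common prefix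
  into the past, and \<open>l - k \<le> l' - k'\<close> says precisely that the pasts of length
  \<open>l'\<close> are long enough to contain the resulting words of length
  \<open>l + j\<close>.\<close>

lemma past_equiv_mono:
  assumes "(x, y) \<in> past_equiv \<alpha> q" "index_le p q" "p \<in> cover_index" "q \<in> cover_index"
  shows "(x, y) \<in> past_equiv \<alpha> p"
proof -
  obtain k l k' l' where pq: "p = (k, l)" "q = (k', l')" by (metis surj_pair)
  have le: "k \<le> k'" "l + (k' - k) \<le> l'"
    using assms(2-4) unfolding pq index_le_def cover_index_def by auto
  define j where "j = k' - k"
  have k': "k' = k + j" using le unfolding j_def by simp
  have xy: "x \<in> sturmian \<alpha>" "y \<in> sturmian \<alpha>" "\<And>i. i < k' \<Longrightarrow> x i = y i"
    "pasts \<alpha> l' ((shift ^^ k') x) = pasts \<alpha> l' ((shift ^^ k') y)"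
    using assms(1) unfolding pq past_equiv_def by auto
  have "pasts \<alpha> (l + j) ((shift ^^ (k + j)) x) = pasts \<alpha> (l + j) ((shift ^^ (k + j)) y)"
    using pasts_mono_cong[OF xy(4)] le unfolding k' by simp
  moreover have "map x [k..<k + j] = map y [k..<k + j]" using xy(3) k' by auto
  ultimately have "pasts \<alpha> l ((shift ^^ k) x) = pasts \<alpha> l ((shift ^^ k) y)"
    by (simp only: pasts_funpow_shift[of \<alpha> l k _ j])
  then show ?thesis using xy le unfolding pq past_equiv_def by auto
qed

lemma equiv_past_equiv: "equiv (sturmian \<alpha>) (past_equiv \<alpha> p)"
  by (cases p) (auto simp: past_equiv_def intro!: equivI refl_onI symI transI)

lemma past_class_eq_iff:
  assumes "x \<in> sturmian \<alpha>" "y \<in> sturmian \<alpha>"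
  shows "past_class \<alpha> p x = past_class \<alpha> p y \<longleftrightarrow> (x, y) \<in> past_equiv \<alpha> p"
  unfolding past_class_def using equiv_past_equiv assms by (rule eq_equiv_class_iff)

text \<open>This makes the shift well defined on classes: position \<open>k + 1\<close> becomes
  position \<open>k\<close>, and pasts of length \<open>l + 1\<close> determine those of length
  \<open>l\<close>.\<close>

lemma past_equiv_shift:
  assumes "(x, y) \<in> past_equiv \<alpha> (k + 1, l + 1)"
  shows "(shift x, shift y) \<in> past_equiv \<alpha> (k, l)"
proof -
  have "pasts \<alpha> l ((shift ^^ (k + 1)) x) = pasts \<alpha> l ((shift ^^ (k + 1)) y)"
    by (rule pasts_mono_cong[of _ "l + 1"]) (use assms in \<open>auto simp: past_equiv_def\<close>)
  then have "pasts \<alpha> l ((shift ^^ k) (shift x)) = pasts \<alpha> l ((shift ^^ k) (shift y))"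
    by (simp add: funpow_swap1)
  then show ?thesis
    using assms by (auto simp: past_equiv_def shift_in_sturmian) (auto simp: shift_def)
qed

text \<open>A class is determined by the pair \<open>f x\<close> of a binary word of length
  \<open>k\<close> and a set of binary words of length \<open>l\<close>. Finiteness makes the
  factors of the projective limit compact.\<close>

lemma finite_past_quotient: "finite (past_quotient \<alpha> p)"
proof -
  obtain k l where p: "p = (k, l)" by fastforce
  define W :: "nat \<Rightarrow> nat list set" where "W n = {\<mu>. set \<mu> \<subseteq> {0, 1} \<and> length \<mu> = n}" for n
  define f where "f x = (map x [0..<k], pasts \<alpha> l ((shift ^^ k) x))" for x
  have fin: "finite (W n)" for n unfolding W_def by (rule finite_lists_length_eq) simp
  have le1: "n \<in> {0, 1}" if "n \<le> 1" for n :: nat using that by auto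
  have "pasts \<alpha> l x \<subseteq> W l" for x
  proof
    fix \<mu> assume mu: "\<mu> \<in> pasts \<alpha> l x"
    have "prepend \<mu> x i = \<mu> ! i" if "i < length \<mu>" for i
      using that by (simp add: prepend_def)
    then have "\<mu> ! i \<le> 1" if "i < length \<mu>" for i
      using sturmian_le_1[of "prepend \<mu> x" \<alpha> i] mu that unfolding pasts_def by auto
    then have "\<forall>a\<in>set \<mu>. a \<le> 1" by (simp add: all_set_conv_all_nth)
    then show "\<mu> \<in> W l" using mu le1 unfolding W_def pasts_def by blast
  qed
  moreover have "map x [0..<k] \<in> W k" if "x \<in> sturmian \<alpha>" for x
    using le1[OF sturmian_le_1[OF that]] unfolding W_def by (simp add: image_subset_iff)
  ultimately have "f ` sturmian \<alpha> \<subseteq> W k \<times> Pow (W l)" unfolding f_def by blast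
  then have fin_f: "finite (f ` sturmian \<alpha>)" using fin by (meson finite_Pow_iff finite_SigmaI finite_subset)
  define g where "g v = {y \<in> sturmian \<alpha>. f y = v}" for v
  have "past_class \<alpha> p x = g (f x)" if "x \<in> sturmian \<alpha>" for x
    using that unfolding past_class_def past_equiv_def p f_def g_def by auto
  then have "past_quotient \<alpha> p \<subseteq> g ` f ` sturmian \<alpha>"
    unfolding past_quotient_def quotient_def past_class_def by auto
  then show ?thesis using fin_f by (meson finite_imageI finite_subset)
qed

section \<open>Markers\<close>

text \<open>Kronecker's approximation theorem for the midpoint of the interval, with half the length
  of the interval as error.\<close>

lemma frac_multiples_dense:
  fixes \<alpha> :: real
  assumes "\<alpha> \<notin> \<rat>" "0 \<le> a" "a < b" "b \<le> 1"
  obtains k :: nat where "a < frac (real k * \<alpha>)" "frac (real k * \<alpha>) < b"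
proof -
  obtain k :: nat where "\<bar>frac (real k * \<alpha>) - (a + b) / 2\<bar> < (b - a) / 2"
    using Kronecker_approx_1_explicit[of \<alpha> "(a + b) / 2" "(b - a) / 2"] assms by auto
  then show ?thesis using that[of k] by (simp add: abs_less_iff field_simps)
qed

text \<open>Some multiple \<open>j * \<alpha>\<close> advances the circle by a small
  \<open>\<beta> < \<delta>\<close>. Steps of this size cannot jump over the arc from
  \<open>0\<close> to \<open>\<delta>\<close>, and about \<open>1 / \<beta>\<close> of them go once
  around from any starting point, which bounds the return time uniformly.\<close>

lemma rotation_uniformly_recurrent:
  fixes \<alpha> :: real
  assumes "\<alpha> \<notin> \<rat>" "0 < \<delta>"
  shows "\<exists>R. \<forall>t. \<exists>i<R. frac (t + real i * \<alpha>) < \<delta>"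
proof -
  obtain j :: nat where j: "0 < frac (real j * \<alpha>)" "frac (real j * \<alpha>) < min \<delta> 1"
    using frac_multiples_dense[of \<alpha> 0 "min \<delta> 1"] assms by auto
  define \<beta> where "\<beta> = frac (real j * \<alpha>)"
  have "\<exists>i < nat \<lceil>1 / \<beta>\<rceil> * j + 1. frac (t + real i * \<alpha>) < \<delta>" for t
  proof -
    \<comment> \<open>The number of \<open>\<beta>\<close>-steps that carry \<open>frac t\<close> to
      \<open>1\<close> or just past it; the overshoot is less than \<open>\<beta>\<close>.\<close>
    define q where "q = nat \<lceil>(1 - frac t) / \<beta>\<rceil>"
    have pos: "0 < (1 - frac t) / \<beta>" using j frac_lt_1[of t] by (simp add: \<beta>_def)
    then have q: "real q = of_int \<lceil>(1 - frac t) / \<beta>\<rceil>" unfolding q_def by simp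
    have "(1 - frac t) / \<beta> \<le> real q" "real q < (1 - frac t) / \<beta> + 1"
      unfolding q by linarith+
    then have bounds: "1 \<le> frac t + real q * \<beta>" "frac t + real q * \<beta> < 1 + \<beta>"
      using j unfolding \<beta>_def[symmetric] by (simp_all add: field_simps)
    have "t + real (q * j) * \<alpha> =
        (frac t + real q * \<beta> - 1) + of_int (\<lfloor>t\<rfloor> + int q * \<lfloor>real j * \<alpha>\<rfloor> + 1)"
      by (simp add: \<beta>_def frac_def algebra_simps)
    then have "frac (t + real (q * j) * \<alpha>) = frac (frac t + real q * \<beta> - 1)"
      by (simp only: frac_add_of_int_right)
    also have "\<dots> = frac t + real q * \<beta> - 1"
      using bounds j unfolding \<beta>_def[symmetric] by (simp add: frac_eq)
    also have "\<dots> < \<delta>" using bounds j unfolding \<beta>_def[symmetric] by simp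
    finally have "frac (t + real (q * j) * \<alpha>) < \<delta>" .
    moreover have "q \<le> nat \<lceil>1 / \<beta>\<rceil>" unfolding q_def
      using j unfolding \<beta>_def[symmetric] by (intro nat_mono ceiling_mono divide_right_mono) auto
    ultimately show ?thesis by (intro exI[of _ "q * j"]) (simp add: less_Suc_eq_le)
  qed
  then show ?thesis by blast
qed

text \<open>The rotation by \<open>j * \<alpha>\<close> is nontrivial since \<open>\<alpha>\<close>
  is irrational, so some arc with letter \<open>0\<close> is carried into the arc with letter
  \<open>1\<close>. By density the orbit of \<open>0\<close> visits it.\<close>

lemma coding_orbit_not_periodic:
  assumes \<alpha>: "\<alpha> \<in> {0<..<1} - \<rat>" and j: "0 < j"
  shows "\<exists>i. coding \<alpha> (frac (real i * \<alpha>)) \<noteq> coding \<alpha> (frac (real (i + j) * \<alpha>))"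
proof -
  define d where "d = frac (real j * \<alpha>)"
  have "real j * \<alpha> \<notin> \<int>"
  proof
    assume "real j * \<alpha> \<in> \<int>"
    then have "real j * \<alpha> / real j \<in> \<rat>" using Ints_subset_Rats by (intro Rats_divide) auto
    then show False using \<alpha> j by simp
  qed
  then have d: "0 < d" "d < 1" unfolding d_def by (auto simp: frac_lt_1)
  have a: "0 < \<alpha>" "\<alpha> < 1" "\<alpha> \<notin> \<rat>" using \<alpha> by auto
  \<comment> \<open>Below \<open>1 - \<alpha>\<close> the letter is \<open>0\<close>; staying below
    \<open>1 - d\<close> keeps the rotation by \<open>d\<close> from wrapping around, and starting
    above \<open>1 - \<alpha> - d\<close> makes it end where the letter is \<open>1\<close>.\<close>
  define b where "b = min (1 - \<alpha>) (1 - d)"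
  obtain i where i: "max 0 (1 - \<alpha> - d) < frac (real i * \<alpha>)" "frac (real i * \<alpha>) < b"
    by (rule frac_multiples_dense[of \<alpha> "max 0 (1 - \<alpha> - d)" b]) (use a d in \<open>auto simp: b_def\<close>)
  have "frac (real (i + j) * \<alpha>) = frac (frac (real i * \<alpha>) + d)"
    unfolding d_def by (simp add: algebra_simps)
  also have "\<dots> = frac (real i * \<alpha>) + d"
    using i d unfolding b_def frac_eq by (auto simp del: frac_gt_0_iff)
  finally show ?thesis using i unfolding b_def coding_def by (intro exI[of _ i]) auto
qed

text \<open>Both arcs of the coding are closed on the left and open on the right, so a small
  positive change of angle does not alter the letter; finitely many letters admit a common
  bound.\<close>

lemma coding_orbit_right_continuous:
  assumes \<alpha>: "\<alpha> \<in> {0<..<1}"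
  shows "\<exists>\<delta>>0. \<forall>s. 0 \<le> s \<and> s < \<delta> \<longrightarrow>
    (\<forall>k<n. coding \<alpha> (frac (s + real k * \<alpha>)) = coding \<alpha> (frac (real k * \<alpha>)))"
proof (induction n)
  case 0
  show ?case by (intro exI[of _ 1]) simp
next
  case (Suc n)
  then obtain \<delta> where \<delta>: "\<delta> > 0" "\<And>s k. 0 \<le> s \<Longrightarrow> s < \<delta> \<Longrightarrow> k < n \<Longrightarrow>
      coding \<alpha> (frac (s + real k * \<alpha>)) = coding \<alpha> (frac (real k * \<alpha>))"
    by blast
  define f where "f = frac (real n * \<alpha>)"
  \<comment> \<open>The distance from \<open>f\<close> to the right end of its coding arc.\<close>
  define \<epsilon> where "\<epsilon> = (if f < 1 - \<alpha> then 1 - \<alpha> - f else 1 - f)"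
  have f: "0 \<le> f" "f < 1" unfolding f_def by (auto simp: frac_lt_1)
  have "coding \<alpha> (frac (s + real n * \<alpha>)) = coding \<alpha> f" if s: "0 \<le> s" "s < \<epsilon>" for s
  proof -
    have "frac (s + real n * \<alpha>) = frac (s + f)" unfolding f_def by simp
    also have "\<dots> = s + f"
      using s f \<alpha> unfolding \<epsilon>_def by (auto simp: frac_eq split: if_splits)
    finally show ?thesis
      using s f \<alpha> unfolding \<epsilon>_def by (auto simp: coding_def split: if_splits)
  qed
  then have "coding \<alpha> (frac (s + real k * \<alpha>)) = coding \<alpha> (frac (real k * \<alpha>))"
    if "0 \<le> s" "s < min \<delta> \<epsilon>" "k < Suc n" for s k
    using that \<delta>(2)[of s k] unfolding f_def by (cases "k = n") auto
  moreover have "min \<delta> \<epsilon> > 0" using \<delta>(1) f unfolding \<epsilon>_def by simp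
  ultimately show ?case by blast
qed

text \<open>
  The word is a prefix of the coding of the orbit of \<open>0\<close>, long enough to have no period up to
  \<open>L\<close>; hence it cannot overlap itself at a distance up to \<open>L\<close>.
\<close>

lemma sturmian_marker:
  assumes \<alpha>: "\<alpha> \<in> {0<..<1} - \<rat>"
  shows "\<exists>n R w.
    (\<forall>x i j. (\<forall>k<n. x (i + k) = w k) \<and> (\<forall>k<n. x (j + k) = w k) \<and> i < j \<longrightarrow> i + L < j) \<and>
    (\<forall>x\<in>sturmian \<alpha>. \<exists>i<R. \<forall>k<n. x (i + k) = w k)"
proof -
  define w where "w k = coding \<alpha> (frac (real k * \<alpha>))" for k
  obtain g where g: "\<And>j. 0 < j \<Longrightarrow> w (g j) \<noteq> w (g j + j)"
    using coding_orbit_not_periodic[OF \<alpha>] unfolding w_def by metis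
  \<comment> \<open>The word contains both letters of the mismatch at \<open>g j\<close> and
    \<open>g j + j\<close> for every lag \<open>j\<close> with \<open>0 < j \<le> L\<close>.\<close>
  define n where "n = Suc (Max ((\<lambda>j. g j + j) ` {..L}))"
  have n: "g j + j < n" if "j \<le> L" for j
    using that unfolding n_def less_Suc_eq_le by (intro Max_ge) auto
  obtain \<delta> where \<delta>: "\<delta> > 0" "\<And>s k. 0 \<le> s \<Longrightarrow> s < \<delta> \<Longrightarrow> k < n \<Longrightarrow>
      coding \<alpha> (frac (s + real k * \<alpha>)) = w k"
    using coding_orbit_right_continuous[of \<alpha> n] \<alpha> unfolding w_def by blast
  obtain R where R: "\<And>t. \<exists>i<R. frac (t + real i * \<alpha>) < \<delta>"
    using rotation_uniformly_recurrent[of \<alpha> \<delta>] \<alpha> \<delta>(1) by blast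
  show ?thesis
  proof (rule exI[of _ n], rule exI[of _ R], rule exI[of _ w], intro conjI allI impI ballI)
    fix x :: "nat \<Rightarrow> nat" and i j
    assume "(\<forall>k<n. x (i + k) = w k) \<and> (\<forall>k<n. x (j + k) = w k) \<and> i < j"
    then have x: "\<And>k. k < n \<Longrightarrow> x (i + k) = w k" "\<And>k. k < n \<Longrightarrow> x (j + k) = w k" and "i < j"
      by auto
    show "i + L < j"
    proof (rule ccontr)
      define l where "l = j - i"
      assume "\<not> i + L < j"
      then have l: "0 < l" "l \<le> L" "j = i + l" using \<open>i < j\<close> unfolding l_def by auto
      have "w (g l + l) = x (i + (g l + l))" using n[OF l(2)] by (simp add: x)
      also have "\<dots> = x (j + g l)" by (simp add: l algebra_simps)
      also have "\<dots> = w (g l)" using n[OF l(2)] by (intro x) simp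
      finally show False using g[OF l(1)] by simp
    qed
  next
    fix x assume "x \<in> sturmian \<alpha>"
    \<comment> \<open>Only a prefix of \<open>x\<close> is known to come from a single angle; length
      \<open>R + n\<close> covers every occurrence of \<open>w\<close> that starts before
      \<open>R\<close>.\<close>
    then obtain t where t: "\<And>i. i < R + n \<Longrightarrow> x i = coding \<alpha> (frac (t + real i * \<alpha>))"
      unfolding mem_sturmian_iff by blast
    obtain i where i: "i < R" "frac (t + real i * \<alpha>) < \<delta>" using R by blast
    have "x (i + k) = w k" if "k < n" for k
    proof -
      have "x (i + k) = coding \<alpha> (frac (t + real i * \<alpha> + real k * \<alpha>))"
        using t[of "i + k"] i that by (simp add: algebra_simps)
      also have "\<dots> = coding \<alpha> (frac (frac (t + real i * \<alpha>) + real k * \<alpha>))" by simp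
      also have "\<dots> = w k" using i that by (intro \<delta>(2)) auto
      finally show ?thesis .
    qed
    then show "\<exists>i<R. \<forall>k<n. x (i + k) = w k" using i by blast
  qed
qed

section \<open>The cover as a dynamical system\<close>

text \<open>The projection of the cover to the subshift. The index \<open>(Suc i, Suc i)\<close> is
  the least one with first component above \<open>i\<close>, so that all elements of the class agree
  at position \<open>i\<close>.\<close>

definition letters :: "cover_point \<Rightarrow> nat \<Rightarrow> nat" where
  "letters c i = representative c (Suc i, Suc i) i"

text \<open>The choice in \<open>representative\<close> is controlled only up to
  \<open>past_equiv\<close>. Just the coordinate \<open>c p\<close> enters, so the lemma can be used
  for \<open>cover_shift \<alpha> c\<close> before that is known to lie in the cover.\<close>

lemma representative_past_class:
  assumes "x \<in> sturmian \<alpha>" "c p = past_class \<alpha> p x"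
  shows "(x, representative c p) \<in> past_equiv \<alpha> p"
proof -
  have "x \<in> c p"
    unfolding assms(2) past_class_def using equiv_class_self[OF equiv_past_equiv assms(1)] .
  then have "representative c p \<in> c p" unfolding representative_def by (rule someI[of "\<lambda>y. y \<in> c p"])
  then show ?thesis unfolding assms(2) past_class_def by simp
qed

lemma past_class_representative:
  assumes "c \<in> cover \<alpha>" "p \<in> cover_index"
  shows "representative c p \<in> sturmian \<alpha>" "c p = past_class \<alpha> p (representative c p)"
proof -
  have "c p \<in> past_quotient \<alpha> p" using assms by (auto simp: cover_def)
  then obtain x where x: "x \<in> sturmian \<alpha>" "c p = past_class \<alpha> p x"
    unfolding past_quotient_def past_class_def by (auto elim: quotientE)
  have *: "(x, representative c p) \<in> past_equiv \<alpha> p"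
    using x by (rule representative_past_class)
  then show "representative c p \<in> sturmian \<alpha>" by (cases p) (auto simp: past_equiv_def)
  then show "c p = past_class \<alpha> p (representative c p)" using * x past_class_eq_iff by metis
qed

lemma cover_compatible:
  assumes "c \<in> cover \<alpha>" "p \<in> cover_index" "q \<in> cover_index" "index_le p q"
  shows "c p = past_class \<alpha> p (representative c q)"
proof -
  have "\<forall>p\<in>cover_index. \<forall>q\<in>cover_index. index_le p q \<longrightarrow>
      c p = past_class \<alpha> p (representative c q)"
    using assms(1) unfolding cover_def mem_Collect_eq by (rule conjunct2)
  then show ?thesis using assms(2-4) by blast
qed

lemma past_equiv_letters: "(x, y) \<in> past_equiv \<alpha> (k, l) \<Longrightarrow> i < k \<Longrightarrow> x i = y i"
  by (auto simp: past_equiv_def)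

lemma representative_letters:
  assumes "c \<in> cover \<alpha>" "i < k" "k \<le> l"
  shows "representative c (k, l) i = letters c i"
proof -
  have ix: "(k, l) \<in> cover_index" "(Suc i, Suc i) \<in> cover_index" "index_le (Suc i, Suc i) (k, l)"
    using assms by (auto simp: cover_index_def index_le_def)
  have "(representative c (k, l), representative c (Suc i, Suc i)) \<in> past_equiv \<alpha> (Suc i, Suc i)"
    using past_class_representative(1) cover_compatible assms(1) ix
    by (intro representative_past_class) blast+
  then show ?thesis unfolding letters_def by (rule past_equiv_letters) simp
qed

text \<open>Passing to a coarser index does not depend on the representative chosen at the finer
  one.\<close>

lemma past_class_mono:
  assumes "x \<in> sturmian \<alpha>" "p \<in> cover_index" "q \<in> cover_index" "index_le p q"
    "c q = past_class \<alpha> q x"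
  shows "past_class \<alpha> p (representative c q) = past_class \<alpha> p x"
proof -
  have *: "(x, representative c q) \<in> past_equiv \<alpha> p"
    using representative_past_class[of x \<alpha> c q, OF assms(1,5)] assms(4,2,3) by (rule past_equiv_mono)
  then have "representative c q \<in> sturmian \<alpha>" by (cases p) (auto simp: past_equiv_def)
  then show ?thesis using * assms(1) past_class_eq_iff by metis
qed

lemma past_class_in_past_quotient: "x \<in> sturmian \<alpha> \<Longrightarrow> past_class \<alpha> p x \<in> past_quotient \<alpha> p"
  unfolding past_class_def past_quotient_def by (rule quotientI)

lemma cover_nonempty: "cover \<alpha> \<noteq> {}"
proof -
  obtain x where x: "x \<in> sturmian \<alpha>" using sturmian_nonempty by blast
  have "(\<lambda>p\<in>cover_index. past_class \<alpha> p x) \<in> cover \<alpha>"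
    unfolding cover_def using x past_class_mono[OF x]
    by (auto simp: past_class_in_past_quotient)
  then show ?thesis by blast
qed

section \<open>The shift on the cover and its compatibility with letters\<close>

lemma cover_shift_apply:
  assumes "k \<le> l"
  shows "cover_shift \<alpha> c (k, l) = past_class \<alpha> (k, l) (shift (representative c (Suc k, Suc l)))"
  using assms by (simp add: cover_shift_def cover_index_def)

text \<open>Adding one to both components preserves \<open>index_le\<close>, so the compatibility of
  \<open>c\<close> at the raised indices descends through \<open>past_equiv_shift\<close>.\<close>

lemma cover_shift_in_cover:
  assumes c: "c \<in> cover \<alpha>"
  shows "cover_shift \<alpha> c \<in> cover \<alpha>"
proof -
  have rep: "shift (representative c (Suc k, Suc l)) \<in> sturmian \<alpha>" if "k \<le> l" for k l
    using that c by (intro shift_in_sturmian past_class_representative(1)) (auto simp: cover_index_def)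
  have compat: "cover_shift \<alpha> c (k, l) = past_class \<alpha> (k, l) (representative (cover_shift \<alpha> c) (k', l'))"
    if ix: "k \<le> l" "k' \<le> l'" "index_le (k, l) (k', l')" for k l k' l'
  proof -
    have "(representative c (Suc k', Suc l'), representative c (Suc k, Suc l)) \<in> past_equiv \<alpha> (Suc k, Suc l)"
      using ix c past_class_representative(1)[OF c] cover_compatible[OF c]
      by (intro representative_past_class) (auto simp: cover_index_def index_le_def)
    then have "(shift (representative c (Suc k', Suc l')), shift (representative c (Suc k, Suc l))) \<in> past_equiv \<alpha> (k, l)"
      using past_equiv_shift by simp
    then have "cover_shift \<alpha> c (k, l) = past_class \<alpha> (k, l) (shift (representative c (Suc k', Suc l')))"
      using past_class_eq_iff[OF rep rep] ix cover_shift_apply by metis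
    also have "\<dots> = past_class \<alpha> (k, l) (representative (cover_shift \<alpha> c) (k', l'))"
      using ix by (intro past_class_mono[symmetric] rep cover_shift_apply) (auto simp: cover_index_def)
    finally show ?thesis .
  qed
  have "cover_shift \<alpha> c \<in> (\<Pi>\<^sub>E p\<in>cover_index. past_quotient \<alpha> p)"
    using rep past_class_in_past_quotient unfolding cover_shift_def
    by (auto simp: cover_index_def)
  then show ?thesis unfolding cover_def using compat by (auto simp: cover_index_def)
qed

lemma funpow_cover_shift_in_cover: "c \<in> cover \<alpha> \<Longrightarrow> (cover_shift \<alpha> ^^ n) c \<in> cover \<alpha>"
  by (induction n) (auto intro: cover_shift_in_cover)

lemma letters_cover_shift:
  assumes c: "c \<in> cover \<alpha>"
  shows "letters (cover_shift \<alpha> c) i = letters c (Suc i)"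
proof -
  have "(shift (representative c (Suc (Suc i), Suc (Suc i))),
      representative (cover_shift \<alpha> c) (Suc i, Suc i)) \<in> past_equiv \<alpha> (Suc i, Suc i)"
    using c
    by (intro representative_past_class shift_in_sturmian past_class_representative(1)
        cover_shift_apply) (auto simp: cover_index_def)
  then have "shift (representative c (Suc (Suc i), Suc (Suc i))) i = letters (cover_shift \<alpha> c) i"
    unfolding letters_def by (rule past_equiv_letters) simp
  then show ?thesis unfolding letters_def shift_def by simp
qed

lemma letters_funpow_cover_shift:
  assumes "c \<in> cover \<alpha>"
  shows "letters ((cover_shift \<alpha> ^^ k) c) i = letters c (i + k)"
  using assms
  by (induction k arbitrary: i) (auto simp: letters_cover_shift funpow_cover_shift_in_cover)

text \<open>The first \<open>n\<close> letters are those of the representative at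
  \<open>(n, n)\<close>, and membership in the subshift is tested on prefixes.\<close>

lemma letters_in_sturmian:
  assumes "c \<in> cover \<alpha>"
  shows "letters c \<in> sturmian \<alpha>"
  unfolding mem_sturmian_iff
proof
  fix n
  have "representative c (n, n) \<in> sturmian \<alpha>"
    using assms by (intro past_class_representative(1)) (auto simp: cover_index_def)
  then obtain t where "\<And>i. i < n \<Longrightarrow> representative c (n, n) i = coding \<alpha> (frac (t + real i * \<alpha>))"
    unfolding mem_sturmian_iff by blast
  then show "\<exists>t. \<forall>i<n. letters c i = coding \<alpha> (frac (t + real i * \<alpha>))"
    using representative_letters[OF assms, of _ n n] by auto
qed

text \<open>
  The coordinate \<open>(k, l)\<close> of \<open>c\<close> with \<open>k > 0\<close> is read off its coordinate \<open>(k, l + 1)\<close>, whose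
  shift is the coordinate \<open>(k - 1, l)\<close> of \<open>cover_shift \<alpha> c\<close>: only the first letter is lost.
\<close>

lemma cover_shift_inject:
  assumes c: "c \<in> cover \<alpha>" and d: "d \<in> cover \<alpha>"
    and eq: "cover_shift \<alpha> c = cover_shift \<alpha> d" "letters c 0 = letters d 0"
  shows "c = d"
proof -
  have Suc_case: "(representative c (Suc k, Suc l), representative d (Suc k, Suc l)) \<in> past_equiv \<alpha> (Suc k, l)"
    if "k \<le> l" for k l
  proof -
    define x y where "x = representative c (Suc k, Suc l)" and "y = representative d (Suc k, Suc l)"
    have xy: "x \<in> sturmian \<alpha>" "y \<in> sturmian \<alpha>" unfolding x_def y_def
      using that c d by (intro past_class_representative(1); simp add: cover_index_def)+
    have "past_class \<alpha> (k, l) (shift x) = past_class \<alpha> (k, l) (shift y)"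
      using eq(1) cover_shift_apply[OF that] unfolding x_def y_def by metis
    then have *: "(shift x, shift y) \<in> past_equiv \<alpha> (k, l)"
      using past_class_eq_iff xy shift_in_sturmian by metis
    have "x 0 = y 0"
      using representative_letters[OF c] representative_letters[OF d] eq(2) that
      unfolding x_def y_def by simp
    moreover have "x (Suc i) = y (Suc i)" if "i < k" for i
      using past_equiv_letters[OF * that] by (simp add: shift_def)
    ultimately have "x i = y i" if "i < Suc k" for i using that by (cases i) auto
    moreover have "pasts \<alpha> l ((shift ^^ Suc k) x) = pasts \<alpha> l ((shift ^^ Suc k) y)"
      using * by (simp add: past_equiv_def funpow_swap1)
    ultimately show ?thesis using xy unfolding x_def[symmetric] y_def[symmetric] past_equiv_def by auto
  qed
  have "c (k, l) = d (k, l)" if "k \<le> l" for k l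
  proof -
    \<comment> \<open>For \<open>k = 0\<close> no letter precedes the position, so the coordinate is
      first replaced by the finer one at \<open>(1, l + 1)\<close>.\<close>
    define k' l' where "k' = (if k = 0 then 1 else k)" and "l' = (if k = 0 then Suc l else l)"
    have kl: "0 < k'" "k' \<le> l'" "index_le (k, l) (k', Suc l')" "index_le (k, l) (k', l')"
      using that unfolding k'_def l'_def index_le_def by auto
    define x y where "x = representative c (k', Suc l')" and "y = representative d (k', Suc l')"
    have ix: "(k, l) \<in> cover_index" "(k', Suc l') \<in> cover_index" "(k', l') \<in> cover_index"
      using kl that by (auto simp: cover_index_def)
    have xy: "x \<in> sturmian \<alpha>" "y \<in> sturmian \<alpha>" unfolding x_def y_def
      using c d ix by (auto intro: past_class_representative)
    have "(x, y) \<in> past_equiv \<alpha> (k', l')"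
      unfolding x_def y_def using Suc_case[of "k' - 1" l'] kl by simp
    then have "(x, y) \<in> past_equiv \<alpha> (k, l)" using past_equiv_mono ix kl by blast
    then have "past_class \<alpha> (k, l) x = past_class \<alpha> (k, l) y" using past_class_eq_iff xy by blast
    then show ?thesis
      unfolding x_def y_def using cover_compatible[OF c] cover_compatible[OF d] ix kl by metis
  qed
  moreover have "c \<in> extensional cover_index" "d \<in> extensional cover_index"
    using c d by (auto simp: cover_def PiE_def)
  ultimately show ?thesis by (intro extensionalityI) (auto simp: cover_index_def)
qed

lemma funpow_cover_shift_inject:
  assumes "c \<in> cover \<alpha>" "d \<in> cover \<alpha>" "(cover_shift \<alpha> ^^ n) c = (cover_shift \<alpha> ^^ n) d"
    "\<And>i. i < n \<Longrightarrow> letters c i = letters d i"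
  shows "c = d"
  using assms
proof (induction n arbitrary: c d)
  case 0
  then show ?case by simp
next
  case (Suc n)
  have cd: "c \<in> cover \<alpha>" "d \<in> cover \<alpha>" "letters c 0 = letters d 0" using Suc.prems by auto
  have "letters (cover_shift \<alpha> c) i = letters (cover_shift \<alpha> d) i" if "i < n" for i
    using that Suc.prems(4)[of "Suc i"] by (simp add: letters_cover_shift cd)
  moreover have "(cover_shift \<alpha> ^^ n) (cover_shift \<alpha> c) = (cover_shift \<alpha> ^^ n) (cover_shift \<alpha> d)"
    using Suc.prems(3) by (simp add: funpow_swap1)
  ultimately have "cover_shift \<alpha> c = cover_shift \<alpha> d"
    using Suc.IH cover_shift_in_cover cd by blast
  then show ?case by (rule cover_shift_inject[OF cd(1,2) _ cd(3)])
qed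

section \<open>Topology of the cover and continuity of its shift\<close>

lemma continuous_map_cover_coordinate:
  assumes "p \<in> cover_index"
  shows "continuous_map (cover_topology \<alpha>) (discrete_topology UNIV) (\<lambda>c. f (c p))"
proof -
  have "continuous_map (cover_topology \<alpha>) (discrete_topology (past_quotient \<alpha> p)) (\<lambda>c. c p)"
    unfolding cover_topology_def
    using assms by (intro continuous_map_from_subtopology continuous_map_product_projection)
  from continuous_map_compose[OF this, of "discrete_topology UNIV" f] show ?thesis
    by (simp add: comp_def)
qed

lemma openin_cover_coordinate:
  assumes "p \<in> cover_index"
  shows "openin (cover_topology \<alpha>) {c \<in> cover \<alpha>. P (c p)}"
  using openin_continuous_map_preimage[OF continuous_map_cover_coordinate[OF assms], of "{True}" \<alpha> P]
  by (simp add: topspace_cover_topology)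

text \<open>A prefix of length \<open>n\<close> is read off the single discrete coordinate
  \<open>(n, n)\<close>.\<close>

lemma openin_cover_letters: "openin (cover_topology \<alpha>) {c \<in> cover \<alpha>. P (map (letters c) [0..<n])}"
proof -
  have "map (letters c) [0..<n] = map (SOME x. x \<in> c (n, n)) [0..<n]" if "c \<in> cover \<alpha>" for c
    using representative_letters[OF that, of _ n n] by (simp add: representative_def)
  then have "{c \<in> cover \<alpha>. P (map (letters c) [0..<n])} =
      {c \<in> cover \<alpha>. P (map (SOME x. x \<in> c (n, n)) [0..<n])}" by (intro Collect_cong conj_cong refl arg_cong[where f = P])
  then show ?thesis
    using openin_cover_coordinate[of "(n, n)" \<alpha> "\<lambda>S. P (map (SOME x. x \<in> S) [0..<n])"]
    by (simp add: cover_index_def)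
qed

lemma Hausdorff_space_cover_topology: "Hausdorff_space (cover_topology \<alpha>)"
  unfolding cover_topology_def
  by (intro Hausdorff_space_subtopology) (simp add: Hausdorff_space_product_topology)

text \<open>Each compatibility condition is the equaliser of two continuous maps into a discrete
  space. The cover is thus closed in a product of finite spaces, which is compact by Tychonoff's
  theorem.\<close>

lemma compact_space_cover_topology: "compact_space (cover_topology \<alpha>)"
proof -
  define P where "P = product_topology (\<lambda>p. discrete_topology (past_quotient \<alpha> p)) cover_index"
  define I where "I = {(p, q). p \<in> cover_index \<and> q \<in> cover_index \<and> index_le p q}"
  define F where "F = (\<lambda>(p, q). {c \<in> topspace P. c p = past_class \<alpha> p (representative c q)})"
  have coord: "continuous_map P (discrete_topology UNIV) (\<lambda>c. f (c p))"
    if "p \<in> cover_index" for f :: "(nat \<Rightarrow> nat) set \<Rightarrow> (nat \<Rightarrow> nat) set" and p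
  proof -
    have "continuous_map P (discrete_topology (past_quotient \<alpha> p)) (\<lambda>c. c p)"
      unfolding P_def using that by (intro continuous_map_product_projection)
    from continuous_map_compose[OF this, of "discrete_topology UNIV" f] show ?thesis
      by (simp add: comp_def)
  qed
  have "closedin P (F i)" if "i \<in> I" for i
  proof -
    from that obtain p q where i: "i = (p, q)" "p \<in> cover_index" "q \<in> cover_index"
      unfolding I_def by blast
    show ?thesis unfolding i F_def prod.case representative_def
      using coord[OF i(2), of "\<lambda>S. S"] coord[OF i(3), of "\<lambda>S. past_class \<alpha> p (SOME x. x \<in> S)"]
      by (intro closedin_continuous_maps_eq[of "discrete_topology UNIV"]) auto
  qed
  then have "closedin P (\<Inter> (insert (topspace P) (F ` I)))" by (intro closedin_Inter) auto
  moreover have "\<Inter> (insert (topspace P) (F ` I)) = cover \<alpha>"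
    unfolding cover_def F_def I_def P_def by auto
  moreover have "compact_space P"
    unfolding P_def
    by (simp add: compact_space_product_topology compact_space_discrete_topology finite_past_quotient)
  ultimately show ?thesis
    unfolding cover_topology_def P_def[symmetric]
    by (metis closedin_compact_space compact_space_subtopology)
qed

text \<open>Coordinate \<open>(k, l)\<close> of the image is a function of coordinate
  \<open>(k + 1, l + 1)\<close> alone, and any function on a discrete space is continuous.\<close>

lemma continuous_map_cover_shift: "continuous_map (cover_topology \<alpha>) (cover_topology \<alpha>) (cover_shift \<alpha>)"
proof -
  have "continuous_map (cover_topology \<alpha>) (discrete_topology (past_quotient \<alpha> (k, l)))
      (\<lambda>c. cover_shift \<alpha> c (k, l))" if kl: "k \<le> l" for k l
  proof -
    have "continuous_map (cover_topology \<alpha>) (discrete_topology UNIV)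
        (\<lambda>c. past_class \<alpha> (k, l) (shift (SOME x. x \<in> c (Suc k, Suc l))))"
      using kl
      by (intro continuous_map_cover_coordinate[where f = "\<lambda>S. past_class \<alpha> (k, l) (shift (SOME x. x \<in> S))"])
        (simp add: cover_index_def)
    then have "continuous_map (cover_topology \<alpha>) (discrete_topology UNIV) (\<lambda>c. cover_shift \<alpha> c (k, l))"
      by (simp only: cover_shift_apply[OF kl] representative_def)
    moreover have "cover_shift \<alpha> c (k, l) \<in> past_quotient \<alpha> (k, l)" if "c \<in> cover \<alpha>" for c
      using cover_shift_in_cover[OF that] kl by (auto simp: cover_def cover_index_def)
    ultimately have "continuous_map (cover_topology \<alpha>)
        (subtopology (discrete_topology UNIV) (past_quotient \<alpha> (k, l))) (\<lambda>c. cover_shift \<alpha> c (k, l))"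
      unfolding continuous_map_in_subtopology topspace_cover_topology by blast
    then show ?thesis by simp
  qed
  then have "continuous_map (cover_topology \<alpha>)
      (product_topology (\<lambda>p. discrete_topology (past_quotient \<alpha> p)) cover_index) (cover_shift \<alpha>)"
    unfolding continuous_map_componentwise by (auto simp: cover_index_def cover_shift_def)
  then show ?thesis
    using cover_shift_in_cover
    by (subst (2) cover_topology_def) (auto simp: continuous_map_in_subtopology topspace_cover_topology)
qed

lemma continuous_map_funpow_cover_shift:
  "continuous_map (cover_topology \<alpha>) (cover_topology \<alpha>) (cover_shift \<alpha> ^^ n)"
proof (induction n)
  case 0
  show ?case using continuous_map_id by (simp add: id_def)
next
  case (Suc n)
  show ?case unfolding funpow.simps
    using Suc continuous_map_cover_shift by (rule continuous_map_compose)
qed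

section \<open>Relatively compact sets of arrows\<close>

lemma sturmian_groupoid_simps:
  "unit_space (sturmian_groupoid \<alpha>) = cover_topology \<alpha>"
  "src (sturmian_groupoid \<alpha>) (x, p, y) = y"
  "rng (sturmian_groupoid \<alpha>) (x, p, y) = x"
  "gmult (sturmian_groupoid \<alpha>) (x, p, y) (y', q, z) = (x, p + q, z)"
  "ginv (sturmian_groupoid \<alpha>) (x, p, y) = (y, - p, x)"
  by (simp_all add: sturmian_groupoid_def)

lemma openin_basic_arrows:
  assumes "openin (cover_topology \<alpha>) U" "openin (cover_topology \<alpha>) V"
  shows "openin (arrow_space (sturmian_groupoid \<alpha>)) (basic_arrows \<alpha> U m n V)"
  unfolding openin_sturmian_groupoid
  using assms by (intro arbitrary_union_of_inc) (auto simp: arrow_basis_def)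

lemma openin_cover: "openin (cover_topology \<alpha>) (cover \<alpha>)"
  using openin_topspace[of "cover_topology \<alpha>"] by (simp add: topspace_cover_topology)

text \<open>Basic sets of different degree are disjoint. Arrows of equal degree differ at an end
  point, which is separated in the Hausdorff space of units.\<close>

lemma Hausdorff_space_arrows: "Hausdorff_space (arrow_space (sturmian_groupoid \<alpha>))"
  unfolding Hausdorff_space_def topspace_sturmian_groupoid
proof (intro allI impI, elim conjE)
  fix g g' :: arrow
  assume g: "g \<in> sturmian_arrows \<alpha>" "g' \<in> sturmian_arrows \<alpha>" and ne: "g \<noteq> g'"
  obtain x p y x' p' y' where g_eq: "g = (x, p, y)" "g' = (x', p', y')"
    by (metis prod_cases3)
  let ?O = "openin (arrow_space (sturmian_groupoid \<alpha>))"
  obtain k l k' l' where kl: "(cover_shift \<alpha> ^^ k) x = (cover_shift \<alpha> ^^ l) y" "p = int k - int l"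
    and kl': "(cover_shift \<alpha> ^^ k') x' = (cover_shift \<alpha> ^^ l') y'" "p' = int k' - int l'"
    and cov: "x \<in> cover \<alpha>" "y \<in> cover \<alpha>" "x' \<in> cover \<alpha>" "y' \<in> cover \<alpha>"
    using g unfolding g_eq sturmian_arrows_def by auto
  have goal: "\<exists>U V. ?O U \<and> ?O V \<and> g \<in> U \<and> g' \<in> V \<and> disjnt U V"
    if "openin (cover_topology \<alpha>) A" "openin (cover_topology \<alpha>) B"
      "openin (cover_topology \<alpha>) A'" "openin (cover_topology \<alpha>) B'"
      "x \<in> A" "y \<in> B" "x' \<in> A'" "y' \<in> B'"
      "p \<noteq> p' \<or> A \<inter> A' = {} \<or> B \<inter> B' = {}" for A B A' B'
  proof (intro exI conjI)
    show "?O (basic_arrows \<alpha> A k l B)" "?O (basic_arrows \<alpha> A' k' l' B')"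
      using that by (auto intro: openin_basic_arrows)
    show "g \<in> basic_arrows \<alpha> A k l B" "g' \<in> basic_arrows \<alpha> A' k' l' B'"
      using that kl kl' unfolding g_eq by (auto simp: basic_arrows_def)
    show "disjnt (basic_arrows \<alpha> A k l B) (basic_arrows \<alpha> A' k' l' B')"
      using that kl kl' by (auto simp: basic_arrows_def disjnt_def)
  qed
  have sep: "\<exists>A A'. openin (cover_topology \<alpha>) A \<and> openin (cover_topology \<alpha>) A' \<and>
      u \<in> A \<and> v \<in> A' \<and> A \<inter> A' = {}" if "u \<in> cover \<alpha>" "v \<in> cover \<alpha>" "u \<noteq> v" for u v
    using Hausdorff_space_cover_topology[of \<alpha>] that
    unfolding Hausdorff_space_def topspace_cover_topology disjnt_def by blast
  consider "p \<noteq> p'" | "x \<noteq> x'" | "y \<noteq> y'" using ne unfolding g_eq by blast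
  then show "\<exists>U V. ?O U \<and> ?O V \<and> g \<in> U \<and> g' \<in> V \<and> disjnt U V"
  proof cases
    case 1
    then show ?thesis using goal openin_cover cov by metis
  next
    case 2
    then obtain A A' where "openin (cover_topology \<alpha>) A" "openin (cover_topology \<alpha>) A'"
      "x \<in> A" "x' \<in> A'" "A \<inter> A' = {}" using sep cov by metis
    then show ?thesis using goal[of A "cover \<alpha>" A' "cover \<alpha>"] openin_cover cov by blast
  next
    case 3
    then obtain B B' where "openin (cover_topology \<alpha>) B" "openin (cover_topology \<alpha>) B'"
      "y \<in> B" "y' \<in> B'" "B \<inter> B' = {}" using sep cov by metis
    then show ?thesis using goal[of "cover \<alpha>" B "cover \<alpha>" B'] openin_cover cov by blast
  qed
qed

text \<open>
  If \<open>m' < m\<close>, then by injectivity of the shift away from the lost letters the relation with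
  exponents \<open>(m', n')\<close> is relatively open in the one with exponents \<open>(m, n)\<close>. This makes the
  topology of a basic set of arrows the product topology.
\<close>

lemma funpow_cover_shift_cancel:
  assumes "x \<in> cover \<alpha>" "y \<in> cover \<alpha>" "m' + j = m" "n' + j = n"
    "(cover_shift \<alpha> ^^ m) x = (cover_shift \<alpha> ^^ n) y"
  shows "(cover_shift \<alpha> ^^ m') x = (cover_shift \<alpha> ^^ n') y \<longleftrightarrow>
    (\<forall>i<j. letters x (i + m') = letters y (i + n'))"
proof
  assume "(cover_shift \<alpha> ^^ m') x = (cover_shift \<alpha> ^^ n') y"
  then have "letters ((cover_shift \<alpha> ^^ m') x) i = letters ((cover_shift \<alpha> ^^ n') y) i" for i
    by simp
  then show "\<forall>i<j. letters x (i + m') = letters y (i + n')"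
    using assms by (simp add: letters_funpow_cover_shift)
next
  assume *: "\<forall>i<j. letters x (i + m') = letters y (i + n')"
  have "(cover_shift \<alpha> ^^ j) ((cover_shift \<alpha> ^^ m') x) = (cover_shift \<alpha> ^^ j) ((cover_shift \<alpha> ^^ n') y)"
    using assms(3-5) by (metis add.commute comp_apply funpow_add)
  then show "(cover_shift \<alpha> ^^ m') x = (cover_shift \<alpha> ^^ n') y"
    by (rule funpow_cover_shift_inject[rotated 2])
      (use assms * in \<open>auto simp: letters_funpow_cover_shift funpow_cover_shift_in_cover\<close>)
qed

text \<open>Agreement at one position is the union, over the common letter \<open>v\<close>, of
  products of open sets; induction on \<open>j\<close> intersects finitely many of these.\<close>

lemma openin_letters_agree:
  fixes \<alpha> :: real
  defines "X \<equiv> prod_topology (cover_topology \<alpha>) (cover_topology \<alpha>)"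
  shows "openin X {z \<in> topspace X. \<forall>i<j. letters (fst z) (i + a) = letters (snd z) (i + b)}"
proof (induction j)
  case 0
  show ?case by simp
next
  case (Suc j)
  have top: "topspace X = cover \<alpha> \<times> cover \<alpha>"
    unfolding X_def by (simp add: topspace_cover_topology)
  have "openin (cover_topology \<alpha>) {c \<in> cover \<alpha>. letters c k = v}" for k v
    using openin_cover_letters[of \<alpha> "\<lambda>w. w ! k = v" "Suc k"] by (simp add: nth_append del: upt_Suc)
  then have "openin X ({x \<in> cover \<alpha>. letters x (j + a) = v} \<times> {y \<in> cover \<alpha>. letters y (j + b) = v})" for v
    unfolding X_def by (simp add: openin_prod_Times_iff)
  then have "openin X (\<Union>v. {x \<in> cover \<alpha>. letters x (j + a) = v} \<times> {y \<in> cover \<alpha>. letters y (j + b) = v})"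
    by (intro openin_Union) blast
  with Suc have "openin X ({z \<in> topspace X. \<forall>i<j. letters (fst z) (i + a) = letters (snd z) (i + b)} \<inter>
      (\<Union>v. {x \<in> cover \<alpha>. letters x (j + a) = v} \<times> {y \<in> cover \<alpha>. letters y (j + b) = v}))"
    by (rule openin_Int)
  also have "\<dots> = {z \<in> topspace X. \<forall>i<Suc j. letters (fst z) (i + a) = letters (snd z) (i + b)}"
    unfolding top by (auto simp: less_Suc_eq)
  finally show ?case .
qed

text \<open>The set is the image under \<open>f\<close> of the equaliser \<open>S\<close>, which is
  closed in the compact square of the cover. Continuity of \<open>f\<close> is checked on basic open
  sets.\<close>

lemma compactin_basic_arrows:
  "compactin (arrow_space (sturmian_groupoid \<alpha>)) (basic_arrows \<alpha> (cover \<alpha>) m n (cover \<alpha>))"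
proof -
  define X where "X = prod_topology (cover_topology \<alpha>) (cover_topology \<alpha>)"
  define S where "S = {z \<in> topspace X. (cover_shift \<alpha> ^^ m) (fst z) = (cover_shift \<alpha> ^^ n) (snd z)}"
  define f :: "cover_point \<times> cover_point \<Rightarrow> arrow" where "f = (\<lambda>(x, y). (x, int m - int n, y))"
  have top: "topspace X = cover \<alpha> \<times> cover \<alpha>"
    unfolding X_def by (simp add: topspace_cover_topology)
  have cont: "continuous_map X (cover_topology \<alpha>) (\<lambda>z. (cover_shift \<alpha> ^^ i) (fst z))"
    "continuous_map X (cover_topology \<alpha>) (\<lambda>z. (cover_shift \<alpha> ^^ i) (snd z))" for i
    unfolding X_def
    using continuous_map_compose[OF continuous_map_fst continuous_map_funpow_cover_shift]
      continuous_map_compose[OF continuous_map_snd continuous_map_funpow_cover_shift]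
    by (simp_all add: comp_def)
  have "closedin X S" unfolding S_def
    by (rule closedin_continuous_maps_eq[OF Hausdorff_space_cover_topology cont])
  moreover have "compact_space X"
    unfolding X_def by (simp add: compact_space_prod_topology compact_space_cover_topology)
  ultimately have comp: "compactin (subtopology X S) S"
    by (simp add: closedin_compact_space compactin_subtopology)
  have agree: "openin X {z \<in> topspace X. \<forall>i<j. letters (fst z) (i + a) = letters (snd z) (i + b)}"
    for j a b unfolding X_def by (rule openin_letters_agree)
  have "continuous_map (subtopology X S) (arrow_space (sturmian_groupoid \<alpha>)) f"
  proof (rule continuous_map_into_topology_base[OF openin_sturmian_groupoid])
    fix z assume "z \<in> topspace (subtopology X S)"
    then show "f z \<in> topspace (arrow_space (sturmian_groupoid \<alpha>))"
      unfolding topspace_sturmian_groupoid sturmian_arrows_def f_def S_def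
      by (auto simp: top) blast
  next
    fix W assume "W \<in> arrow_basis \<alpha>"
    then obtain U m' n' V where W: "W = basic_arrows \<alpha> U m' n' V"
      and op: "openin (cover_topology \<alpha>) U" "openin (cover_topology \<alpha>) V"
      unfolding arrow_basis_def by blast
    have UV: "openin X (U \<times> V)" unfolding X_def using op by (simp add: openin_prod_Times_iff)
    have sub: "U \<subseteq> cover \<alpha>" "V \<subseteq> cover \<alpha>"
      using op openin_subset by (auto simp flip: topspace_cover_topology)
    have *: "openin (subtopology X S) {z \<in> topspace (subtopology X S). f z \<in> W}"
      if T: "openin X T" "{z \<in> S. f z \<in> W} = S \<inter> T" for T
    proof -
      have "topspace (subtopology X S) = S" unfolding S_def by auto
      then show ?thesis using that unfolding openin_subtopology by (auto simp: Int_commute)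
    qed
    \<comment> \<open>A basic set of another degree has empty preimage. Larger exponents impose no
      new condition on \<open>S\<close>, while smaller ones require in addition that
      \<open>j\<close> pairs of letters agree, an open condition.\<close>
    consider (ne) "int m - int n \<noteq> int m' - int n'"
      | (ge) j where "m' = j + m" "n' = j + n"
      | (lt) j where "m' + j = m" "n' + j = n"
    proof -
      have "\<exists>j. m' = j + m \<and> n' = j + n" if "int m - int n = int m' - int n'" "m \<le> m'"
        using that by (intro exI[of _ "m' - m"]) auto
      moreover have "\<exists>j. m' + j = m \<and> n' + j = n" if "int m - int n = int m' - int n'" "m' \<le> m"
        using that by (intro exI[of _ "m - m'"]) auto
      ultimately show thesis using that nat_le_linear[of m m'] by blast
    qed
    then show "openin (subtopology X S) {z \<in> topspace (subtopology X S). f z \<in> W}"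
    proof cases
      case ne
      then have "{z \<in> S. f z \<in> W} = S \<inter> {}" unfolding W f_def basic_arrows_def by auto
      then show ?thesis by (rule *[rotated]) simp
    next
      case ge
      have "{z \<in> S. f z \<in> W} = S \<inter> (U \<times> V)"
        unfolding W f_def basic_arrows_def S_def ge by (auto simp: funpow_add)
      then show ?thesis by (rule *[OF UV])
    next
      case (lt j)
      have "int m' - int n' = int m - int n" using lt by auto
      then have "{z \<in> S. f z \<in> W} = S \<inter> {z \<in> U \<times> V. (cover_shift \<alpha> ^^ m') (fst z) = (cover_shift \<alpha> ^^ n') (snd z)}"
        unfolding W f_def basic_arrows_def by auto
      also have "\<dots> = S \<inter> (U \<times> V \<inter> {z \<in> topspace X. \<forall>i<j. letters (fst z) (i + m') = letters (snd z) (i + n')})"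
      proof -
        have "(cover_shift \<alpha> ^^ m') (fst z) = (cover_shift \<alpha> ^^ n') (snd z) \<longleftrightarrow>
            (\<forall>i<j. letters (fst z) (i + m') = letters (snd z) (i + n'))" if "z \<in> S" for z
          using that lt unfolding S_def top by (intro funpow_cover_shift_cancel[of _ \<alpha>]) auto
        moreover have "S \<subseteq> topspace X" unfolding S_def by blast
        ultimately show ?thesis by blast
      qed
      finally show ?thesis by (rule *[OF openin_Int[OF UV agree]])
    qed
  qed
  then have "compactin (arrow_space (sturmian_groupoid \<alpha>)) (f ` S)"
    using comp image_compactin by blast
  moreover have "f ` S = basic_arrows \<alpha> (cover \<alpha>) m n (cover \<alpha>)"
    unfolding f_def S_def top basic_arrows_def by force
  ultimately show ?thesis by simp
qed

section \<open>Exhaustion of the arrow space by compact open sets\<close>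

definition bounded_arrows :: "real \<Rightarrow> nat \<Rightarrow> arrow set" where
  "bounded_arrows \<alpha> N = (\<Union>m\<le>N. \<Union>n\<le>N. basic_arrows \<alpha> (cover \<alpha>) m n (cover \<alpha>))"

lemma bounded_arrows_mono: "N \<le> N' \<Longrightarrow> bounded_arrows \<alpha> N \<subseteq> bounded_arrows \<alpha> N'"
  unfolding bounded_arrows_def by (auto intro: order_trans)

text \<open>The sets \<open>bounded_arrows \<alpha> N\<close> are open and increase to the whole
  space, so a compact closure lies in one of them. Conversely they are compact in a Hausdorff space,
  hence closed, and contain the closure of each subset.\<close>

lemma relatively_compact_arrows_iff:
  "relatively_compact_in (arrow_space (sturmian_groupoid \<alpha>)) S \<longleftrightarrow> (\<exists>N. S \<subseteq> bounded_arrows \<alpha> N)"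
  (is "relatively_compact_in ?T S \<longleftrightarrow> _")
proof
  assume "relatively_compact_in ?T S"
  then have S: "S \<subseteq> topspace ?T" "compactin ?T (?T closure_of S)"
    unfolding relatively_compact_in_def by auto
  have op: "openin ?T (bounded_arrows \<alpha> N)" for N
    unfolding bounded_arrows_def by (intro openin_Union) (auto intro!: openin_basic_arrows openin_cover)
  have "sturmian_arrows \<alpha> \<subseteq> \<Union>(range (bounded_arrows \<alpha>))"
  proof
    fix g assume "g \<in> sturmian_arrows \<alpha>"
    then obtain k l where "g \<in> basic_arrows \<alpha> (cover \<alpha>) k l (cover \<alpha>)"
      by (auto simp: sturmian_arrows_def basic_arrows_def)
    then have "g \<in> bounded_arrows \<alpha> (max k l)"
      unfolding bounded_arrows_def by (blast intro: max.cobounded1 max.cobounded2)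
    then show "g \<in> \<Union>(range (bounded_arrows \<alpha>))" by blast
  qed
  then have "?T closure_of S \<subseteq> \<Union>(range (bounded_arrows \<alpha>))"
    using closure_of_subset_topspace[of ?T S] by (simp add: topspace_sturmian_groupoid)
  then obtain \<F> where \<F>: "finite \<F>" "\<F> \<subseteq> range (bounded_arrows \<alpha>)" "?T closure_of S \<subseteq> \<Union>\<F>"
    using compactinD[OF S(2), of "range (bounded_arrows \<alpha>)"] op by blast
  obtain I where I: "finite I" "\<F> = bounded_arrows \<alpha> ` I"
    using \<F>(1,2) by (meson finite_subset_image)
  obtain N where "I \<subseteq> {..<N}" using I(1) finite_nat_iff_bounded by blast
  then have "\<Union>\<F> \<subseteq> bounded_arrows \<alpha> N"
    unfolding I(2) by (intro UN_least bounded_arrows_mono) auto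
  then show "\<exists>N. S \<subseteq> bounded_arrows \<alpha> N"
    using \<F>(3) closure_of_subset[OF S(1)] by blast
next
  assume "\<exists>N. S \<subseteq> bounded_arrows \<alpha> N"
  then obtain N where N: "S \<subseteq> bounded_arrows \<alpha> N" by blast
  have comp: "compactin ?T (bounded_arrows \<alpha> N)"
    unfolding bounded_arrows_def by (intro compactin_Union) (auto intro!: compactin_Union compactin_basic_arrows)
  then have "closedin ?T (bounded_arrows \<alpha> N)"
    by (rule compactin_imp_closedin[OF Hausdorff_space_arrows])
  then have "compactin ?T (?T closure_of S)"
    using closed_compactin[OF comp closure_of_minimal[OF N]] by simp
  then show "relatively_compact_in ?T S"
    using N compactin_subset_topspace[OF comp] unfolding relatively_compact_in_def by blast
qed

section \<open>Dynamic asymptotic dimension\<close>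

lemma not_dad_at_most_0: "\<not> dad_at_most (sturmian_groupoid \<alpha>) 0"
proof
  let ?G = "sturmian_groupoid \<alpha>"
  define K where "K = basic_arrows \<alpha> (cover \<alpha>) 1 0 (cover \<alpha>)"
  assume "dad_at_most ?G 0"
  moreover have "openin (arrow_space ?G) K"
    unfolding K_def by (intro openin_basic_arrows openin_cover)
  moreover have "relatively_compact_in (arrow_space ?G) K"
    unfolding relatively_compact_arrows_iff K_def bounded_arrows_def by (intro exI[of _ 1]) auto
  ultimately obtain U :: "nat \<Rightarrow> cover_point set" where
    U: "src ?G ` K \<union> rng ?G ` K \<subseteq> U 0"
      "relatively_compact_in (arrow_space ?G)
        (subgroupoid ?G hull {g \<in> K. src ?G g \<in> U 0 \<and> rng ?G g \<in> U 0})"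
    unfolding dad_at_most_def by auto
  \<comment> \<open>A single set \<open>U 0\<close> contains all end points of \<open>K\<close>, so
    restricting \<open>K\<close> to it loses nothing.\<close>
  have "{g \<in> K. src ?G g \<in> U 0 \<and> rng ?G g \<in> U 0} = K" using U(1) by auto
  with U(2) obtain N where N: "subgroupoid ?G hull K \<subseteq> bounded_arrows \<alpha> N"
    unfolding relatively_compact_arrows_iff by auto
  obtain c where c: "c \<in> cover \<alpha>" using cover_nonempty by blast
  have step: "((cover_shift \<alpha> ^^ n) c, 1, (cover_shift \<alpha> ^^ Suc n) c) \<in> K" for n
    unfolding K_def basic_arrows_def
    using funpow_cover_shift_in_cover[OF c, of n] funpow_cover_shift_in_cover[OF c, of "Suc n"] by simp
  \<comment> \<open>The hull is the intersection of all subgroupoids containing \<open>K\<close>, so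
    the claim is shown for each such \<open>H\<close>.\<close>
  have "(c, int (Suc n), (cover_shift \<alpha> ^^ Suc n) c) \<in> H" if "subgroupoid ?G H" "K \<subseteq> H" for n H
  proof (induction n)
    case 0
    then show ?case using step[of 0] that(2) by auto
  next
    case (Suc n)
    have next_step: "((cover_shift \<alpha> ^^ Suc n) c, 1, (cover_shift \<alpha> ^^ Suc (Suc n)) c) \<in> H"
      using step[of "Suc n"] that(2) by blast
    have "gmult ?G g h \<in> H" if "g \<in> H" "h \<in> H" "src ?G g = rng ?G h" for g h
      using \<open>subgroupoid ?G H\<close> that unfolding subgroupoid_def by blast
    from this[OF Suc next_step] have "gmult ?G (c, int (Suc n), (cover_shift \<alpha> ^^ Suc n) c)
        ((cover_shift \<alpha> ^^ Suc n) c, 1, (cover_shift \<alpha> ^^ Suc (Suc n)) c) \<in> H"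
      by (simp only: sturmian_groupoid_simps)
    then show ?case by (simp add: sturmian_groupoid_simps add.commute)
  qed
  then have "(c, int (Suc N), (cover_shift \<alpha> ^^ Suc N) c) \<in> subgroupoid ?G hull K"
    unfolding hull_def by blast
  then have "(c, int (Suc N), (cover_shift \<alpha> ^^ Suc N) c) \<in> bounded_arrows \<alpha> N" using N by blast
  \<comment> \<open>Arrows in \<open>bounded_arrows \<alpha> N\<close> have degree at most
    \<open>N\<close>.\<close>
  then show False unfolding bounded_arrows_def basic_arrows_def by auto
qed

text \<open>The map sending \<open>t\<close> to \<open>t - m + n\<close> carries times of
  \<open>A\<close> from \<open>m\<close> on to times of \<open>B\<close>. The last hypothesis keeps
  the image of the first \<open>A\<close>-time after \<open>N\<close> beyond \<open>N\<close>, so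
  this image bounds the first \<open>B\<close>-time there. Exchanging the roles of \<open>A\<close>
  and \<open>B\<close> yields the reverse inequality.\<close>

lemma Least_shift_le:
  fixes A B :: "nat \<Rightarrow> bool"
  assumes "\<And>a. A (a + m) \<longleftrightarrow> B (a + n)" "m \<le> N" "\<exists>t>N. A t"
    "\<And>t. N < t \<Longrightarrow> A t \<Longrightarrow> N + m < t + n"
  shows "(LEAST t. N < t \<and> B t) + m \<le> (LEAST t. N < t \<and> A t) + n"
proof -
  define s where "s = (LEAST t. N < t \<and> A t)"
  have s: "N < s" "A s" unfolding s_def using LeastI_ex[OF assms(3)] by auto
  have "A ((s - m) + m)" using s assms(2) by simp
  then have "B (s - m + n)" using assms(1) by blast
  moreover have "N < s - m + n" using assms(4)[OF s] s assms(2) by linarith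
  ultimately have "(LEAST t. N < t \<and> B t) \<le> s - m + n" by (intro Least_le) auto
  then show ?thesis unfolding s_def[symmetric] using s assms(2) by linarith
qed

text \<open>
  \<open>A\<close> and \<open>B\<close> are the marker times of two points that meet after \<open>m\<close>, respectively \<open>n\<close>, steps.
\<close>

lemma next_marker_shift_le:
  fixes A B :: "nat \<Rightarrow> bool"
  assumes shift: "\<And>a. A (a + m) \<longleftrightarrow> B (a + n)" and mn: "m \<le> N" "n \<le> N"
    and ex: "\<exists>t>N. A t"
    and gap: "\<And>i j. A i \<Longrightarrow> A j \<Longrightarrow> i < j \<Longrightarrow> i + (2 * N + 1) < j"
    and case_split: "(\<forall>t\<le>N. \<not> B t) \<or> (\<exists>t\<le>N. A t)"
  shows "(LEAST t. N < t \<and> B t) + m \<le> (LEAST t. N < t \<and> A t) + n"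
proof (rule Least_shift_le[OF shift mn(1) ex])
  fix t assume t: "N < t" "A t"
  from case_split show "N + m < t + n"
  proof
    \<comment> \<open>The translated time is a \<open>B\<close>-time, so without early
      \<open>B\<close>-times it must exceed \<open>N\<close>.\<close>
    assume B: "\<forall>t\<le>N. \<not> B t"
    have "B (t - m + n)" using t mn shift[of "t - m"] by simp
    then have "N < t - m + n" using B not_le by blast
    then show ?thesis using t mn by linarith
  next
    \<comment> \<open>An early \<open>A\<close>-time forces the next one beyond
      \<open>2 * N + 1\<close>, hence beyond \<open>N + m\<close>.\<close>
    assume "\<exists>i\<le>N. A i"
    then obtain i where "i \<le> N" "A i" by blast
    then show ?thesis using gap[of i t] t mn by linarith
  qed
qed

lemma dad_at_most_1:
  assumes \<alpha>: "\<alpha> \<in> {0<..<1} - \<rat>"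
  shows "dad_at_most (sturmian_groupoid \<alpha>) 1"
  unfolding dad_at_most_def
proof (intro allI impI, elim conjE)
  let ?G = "sturmian_groupoid \<alpha>"
  fix K assume "openin (arrow_space ?G) K" "relatively_compact_in (arrow_space ?G) K"
  then obtain N where K: "K \<subseteq> bounded_arrows \<alpha> N" unfolding relatively_compact_arrows_iff by blast
  obtain n R :: nat and w :: "nat \<Rightarrow> nat" where
    gap: "\<forall>x i j. (\<forall>k<n. x (i + k) = w k) \<and> (\<forall>k<n. x (j + k) = w k) \<and> i < j
      \<longrightarrow> i + (2 * N + 1) < j" and
    hit: "\<forall>x\<in>sturmian \<alpha>. \<exists>i<R. \<forall>k<n. x (i + k) = w k"
    using sturmian_marker[OF \<alpha>, of "2 * N + 1"] by blast
  define M where "M c i \<longleftrightarrow> (\<forall>k<n. letters c (i + k) = w k)" for c i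
  define s where "s c = (LEAST t. N < t \<and> M c t)" for c
  define e where "e c = (cover_shift \<alpha> ^^ s c) c" for c
  \<comment> \<open>Every index other than \<open>0\<close> gives the points without a marker up to
    time \<open>N\<close>.\<close>
  define U where "U i = {c \<in> cover \<alpha>. (\<exists>j\<le>N. M c j) \<longleftrightarrow> i = (0 :: nat)}" for i
  \<comment> \<open>The relation \<open>e x = e y\<close> is an equivalence and the degree is a
    difference of values of \<open>s\<close>, which is why \<open>H\<close> is closed under products
    and inverses.\<close>
  define H where "H = {(x, p, y). x \<in> cover \<alpha> \<and> y \<in> cover \<alpha> \<and> e x = e y \<and> p = int (s x) - int (s y)}"
  have gapM: "i + (2 * N + 1) < j" if "M c i" "M c j" "i < j" for c i j
    using gap[rule_format, of "letters c" i j] that unfolding M_def by blast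
  have next_M: "\<exists>t>N. t \<le> N + R + 1 \<and> M c t" if c: "c \<in> cover \<alpha>" for c
  proof -
    \<comment> \<open>Deleting the first \<open>Suc N\<close> letters makes the marker found lie
      strictly after time \<open>N\<close>.\<close>
    obtain i where i: "i < R" "\<forall>k<n. (shift ^^ Suc N) (letters c) (i + k) = w k"
      using hit[rule_format, OF funpow_shift_in_sturmian[OF letters_in_sturmian[OF c]]] by blast
    then have "M c (i + Suc N)" unfolding M_def funpow_shift by (simp add: add_ac)
    then show ?thesis using i by (intro exI[of _ "i + Suc N"]) auto
  qed
  have s: "N < s c" "s c \<le> N + R + 1" if c: "c \<in> cover \<alpha>" for c
  proof -
    obtain t where t: "N < t" "t \<le> N + R + 1" "M c t" using next_M[OF c] by blast
    show "N < s c" unfolding s_def using LeastI[of "\<lambda>t. N < t \<and> M c t" t] t by blast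
    show "s c \<le> N + R + 1" unfolding s_def using Least_le[of "\<lambda>t. N < t \<and> M c t" t] t by simp
  qed
  have M_shift: "M ((cover_shift \<alpha> ^^ k) c) i \<longleftrightarrow> M c (i + k)" if "c \<in> cover \<alpha>" for c i k
    unfolding M_def using that by (simp add: letters_funpow_cover_shift add_ac)
  have arrow: "s x - m = s y - k \<and> e x = e y"
    if xy: "x \<in> U i" "y \<in> U i" "(cover_shift \<alpha> ^^ m) x = (cover_shift \<alpha> ^^ k) y" "m \<le> N" "k \<le> N"
    for x y i m k
  proof -
    have cov: "x \<in> cover \<alpha>" "y \<in> cover \<alpha>" using xy unfolding U_def by auto
    have sh: "M x (a + m) \<longleftrightarrow> M y (a + k)" for a
      using M_shift cov xy(3) by metis
    have ex: "\<exists>t>N. M x t" "\<exists>t>N. M y t" using next_M cov by blast+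
    \<comment> \<open>Points of the same \<open>U i\<close> either both have an early marker or both
      have none, so the case distinction is available in both directions.\<close>
    have both: "(\<forall>t\<le>N. \<not> M y t) \<or> (\<exists>t\<le>N. M x t)" "(\<forall>t\<le>N. \<not> M x t) \<or> (\<exists>t\<le>N. M y t)"
      using xy(1,2) unfolding U_def by auto
    have "s y + m \<le> s x + k"
      unfolding s_def
      by (rule next_marker_shift_le[where A = "M x" and B = "M y" and N = N])
        (rule sh xy(4,5) ex(1) both(1) | erule (2) gapM)+
    moreover have "s x + k \<le> s y + m"
      unfolding s_def
      by (rule next_marker_shift_le[where A = "M y" and B = "M x" and N = N])
        (rule sh[symmetric] xy(4,5) ex(2) both(2) | erule (2) gapM)+
    \<comment> \<open>The subtractions are exact because \<open>m\<close> and \<open>k\<close> are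
      at most \<open>N\<close>, which is below \<open>s x\<close> and \<open>s y\<close>.\<close>
    ultimately have d: "s x - m = s y - k" "s x = (s x - m) + m" "s y = (s y - k) + k"
      using s(1)[OF cov(1)] s(1)[OF cov(2)] xy(4,5) by linarith+
    have "e x = (cover_shift \<alpha> ^^ (s x - m)) ((cover_shift \<alpha> ^^ m) x)"
      unfolding e_def using d(2) by (metis comp_apply funpow_add)
    also have "\<dots> = (cover_shift \<alpha> ^^ (s y - k)) ((cover_shift \<alpha> ^^ k) y)"
      by (simp only: d(1) xy(3))
    also have "\<dots> = e y"
      unfolding e_def using d(3) by (metis comp_apply funpow_add)
    finally show ?thesis using d(1) by blast
  qed
  have H_sub: "H \<subseteq> bounded_arrows \<alpha> (N + R + 1)"
    unfolding H_def bounded_arrows_def basic_arrows_def e_def using s(2) by fastforce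
  have H: "subgroupoid ?G H"
    unfolding subgroupoid_def
  proof (intro conjI)
    show "H \<subseteq> topspace (arrow_space ?G)"
      unfolding topspace_sturmian_groupoid sturmian_arrows_def H_def e_def by blast
  qed (auto simp: H_def sturmian_groupoid_simps)
  have KH: "{g \<in> K. src ?G g \<in> U i \<and> rng ?G g \<in> U i} \<subseteq> H" for i
  proof clarify
    fix x p y assume g: "(x, p, y) \<in> K" "src ?G (x, p, y) \<in> U i" "rng ?G (x, p, y) \<in> U i"
    then obtain m k where mk: "m \<le> N" "k \<le> N" "p = int m - int k"
      "(cover_shift \<alpha> ^^ m) x = (cover_shift \<alpha> ^^ k) y"
      using K unfolding bounded_arrows_def basic_arrows_def by blast
    have U: "x \<in> U i" "y \<in> U i" using g by (auto simp: sturmian_groupoid_simps)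
    then have cov: "x \<in> cover \<alpha>" "y \<in> cover \<alpha>" unfolding U_def by auto
    show "(x, p, y) \<in> H"
      unfolding H_def using arrow[OF U mk(4,1,2)] cov s(1)[OF cov(1)] s(1)[OF cov(2)] mk by auto
  qed
  have openU: "openin (cover_topology \<alpha>) (U i)" for i
  proof -
    \<comment> \<open>A word of length \<open>n\<close> starting at a time up to \<open>N\<close>
      ends within the first \<open>N + n\<close> letters, so membership in \<open>U i\<close>
      depends on a finite prefix only.\<close>
    define P where "P v \<longleftrightarrow> (\<exists>j\<le>N. \<forall>k<n. v ! (j + k) = w k) \<longleftrightarrow> i = 0" for v :: "nat list"
    have "(\<exists>j\<le>N. M c j) \<longleftrightarrow> (\<exists>j\<le>N. \<forall>k<n. map (letters c) [0..<N + n] ! (j + k) = w k)" for c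
      unfolding M_def by (intro ex_cong conj_cong refl) auto
    then have "U i = {c \<in> cover \<alpha>. P (map (letters c) [0..<N + n])}"
      unfolding U_def P_def by simp
    then show ?thesis using openin_cover_letters by simp
  qed
  have K_cover: "src ?G g \<in> cover \<alpha>" "rng ?G g \<in> cover \<alpha>" if "g \<in> K" for g
    using that K unfolding bounded_arrows_def basic_arrows_def by (auto simp: sturmian_groupoid_simps)
  have "cover \<alpha> \<subseteq> (\<Union>i\<le>1. U i)" unfolding U_def by (auto simp: atMost_Suc)
  then have "src ?G ` K \<union> rng ?G ` K \<subseteq> (\<Union>i\<le>1. U i)"
    using K_cover by blast
  moreover have "relatively_compact_in (arrow_space ?G)
      (subgroupoid ?G hull {g \<in> K. src ?G g \<in> U i \<and> rng ?G g \<in> U i})" for i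
    unfolding relatively_compact_arrows_iff
    using hull_minimal[of _ H "subgroupoid ?G", OF KH H] H_sub by (meson subset_trans)
  ultimately show "\<exists>U :: nat \<Rightarrow> cover_point set.
      (\<forall>i\<le>1. openin (unit_space ?G) (U i)) \<and> src ?G ` K \<union> rng ?G ` K \<subseteq> (\<Union>i\<le>1. U i) \<and>
      (\<forall>i\<le>1. relatively_compact_in (arrow_space ?G)
        (subgroupoid ?G hull {g \<in> K. src ?G g \<in> U i \<and> rng ?G g \<in> U i}))"
    using openU by (intro exI[of _ U]) (simp add: sturmian_groupoid_simps)
qed

theorem theorem5p10:
  fixes \<alpha> :: real
  assumes "\<alpha> \<in> {0<..<1} - \<rat>"
  shows "dyn_asymp_dim (sturmian_groupoid \<alpha>) = 1"
  unfolding dyn_asymp_dim_def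
proof (rule antisym)
  show "Inf {enat d | d. dad_at_most (sturmian_groupoid \<alpha>) d} \<le> 1"
    using dad_at_most_1[OF assms] by (intro Inf_lower) (auto simp: one_enat_def)
  have "1 \<le> d" if "dad_at_most (sturmian_groupoid \<alpha>) d" for d
    using that not_dad_at_most_0[of \<alpha>] by (cases d) auto
  then show "1 \<le> Inf {enat d | d. dad_at_most (sturmian_groupoid \<alpha>) d}"
    by (intro Inf_greatest) (auto simp: one_enat_def)
qed

end
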